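(* Let $n\ge 2$ be an integer. The quadratic unitary Cayley graph $\mathcal{G}_{\mathbb{Z}_n}$ exhibits perfect state transfer if and only if $n\in\{10,20\}$ or $n=2^\alpha 3^\beta$ for some integers $\alpha,\beta$ with $1\le\alpha\le 3$ and $0\le\beta\le 1$.
   Context: Quadratic unitary Cayley graph: let $\mathbb{Z}_n$ be the ring of integers modulo $n$, $\mathbb{Z}_n^*$ its group of units, $Q_n=\{r^2: r\in\mathbb{Z}_n^*\}$ and $V_n=Q_n\cup(-Q_n)$. The graph $\mathcal{G}_{\mathbb{Z}_n}$ has vertex set $\mathbb{Z}_n$, and $u,v$ are adjacent if and only if $u-v\in V_n$. Grover walk: for a finite simple connected graph $G$ with vertex set $V(G)$ and edge set $E(G)$, let $\mathcal{A}(G)=\{(u,v),(v,u): uv\in E(G)\}$ be its set of arcs; for an arc $a=(u,v)$ put $o(a)=u$, $t(a)=v$, $a^{-1}=(v,u)$. Define the boundary matrix $N\in\mathbb{C}^{V(G)\times\mathcal{A}(G)}$ by $N_{xa}=\frac{1}{\sqrt{\deg x}}\delta_{x,t(a)}$, the coin matrix $C=2N^*N-I$, the shift matrix $R\in\mathbb{C}^{\mathcal{A}(G)\times\mathcal{A}(G)}$ by $R_{ab}=\delta_{a,b^{-1}}$, and the time evolution matrix $U=RC$. Perfect state transfer (between vertex-type states): for $u\in V(G)$ let $\mathbf{e}_u\in\mathbb{C}^{V(G)}$ be the unit vector $(\mathbf{e}_u)_x=\delta_{u,x}$. The graph $G$ exhibits perfect state transfer from vertex $u$ to vertex $v$ at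 time $\tau$ (a positive integer) if there is a unimodular complex number $\gamma$ with $U^\tau N^*\mathbf{e}_u=\gamma N^*\mathbf{e}_v$. The graph $G$ exhibits perfect state transfer if this happens for some pair of distinct vertices $u\neq v$ and some positive integer $\tau$. *)

theory Defs
  imports
    Complex_Main
    "HOL-Number_Theory.Residues"
    "Graph_Theory.Graph_Theory"
begin

section \<open>Matrices indexed by finite sets\<close>

text \<open>
  A complex matrix in \<open>\<complex>\<^bsup>I \<times> J\<^esup>\<close> is a function of type \<open>'i \<Rightarrow> 'j \<Rightarrow> complex\<close>, of which only the
  entries in \<open>I \<times> J\<close> matter. The product takes the index set \<open>J\<close> that is summed over as its
  first argument.
\<close>

type_synonym ('i, 'j) cmat = "'i \<Rightarrow> 'j \<Rightarrow> complex"

definition cmat_mult :: "'j set \<Rightarrow> ('i, 'j) cmat \<Rightarrow> ('j, 'k) cmat \<Rightarrow> ('i, 'k) cmat" where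
  "cmat_mult J A B = (\<lambda>i k. \<Sum>j\<in>J. A i j * B j k)"

definition cmat_one :: "('i, 'i) cmat" where
  "cmat_one = (\<lambda>i j. if i = j then 1 else 0)"

definition cmat_adjoint :: "('i, 'j) cmat \<Rightarrow> ('j, 'i) cmat" where
  "cmat_adjoint A = (\<lambda>j i. cnj (A i j))"

primrec cmat_pow :: "'i set \<Rightarrow> ('i, 'i) cmat \<Rightarrow> nat \<Rightarrow> ('i, 'i) cmat" where
  "cmat_pow I A 0 = cmat_one"
| "cmat_pow I A (Suc k) = cmat_mult I A (cmat_pow I A k)"

definition cmat_vec :: "'j set \<Rightarrow> ('i, 'j) cmat \<Rightarrow> ('j \<Rightarrow> complex) \<Rightarrow> 'i \<Rightarrow> complex" where
  "cmat_vec J A x = (\<lambda>i. \<Sum>j\<in>J. A i j * x j)"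

section \<open>The Grover walk\<close>

text \<open>
  A finite simple graph is a symmetric loop-free finite pair digraph (locale \<^locale>\<open>pair_graph\<close>):
  \<^const>\<open>parcs\<close> is its set of arcs, the origin and terminus of an arc are \<^const>\<open>fst\<close> and
  \<^const>\<open>snd\<close>, and the inverse arc is obtained by \<^const>\<open>prod.swap\<close>. Every edge at \<open>x\<close> gives exactly
  one arc with origin \<open>x\<close>, so the degree of \<open>x\<close> is its out-degree.
\<close>

definition boundary_matrix :: "'a pair_pre_digraph \<Rightarrow> ('a, 'a \<times> 'a) cmat" where
  "boundary_matrix G =
    (\<lambda>x a. complex_of_real (1 / sqrt (real (out_degree (with_proj G) x)))
             * (if x = snd a then 1 else 0))"

definition coin_matrix :: "'a pair_pre_digraph \<Rightarrow> ('a \<times> 'a, 'a \<times> 'a) cmat" where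
  "coin_matrix G =
    (\<lambda>a b. 2 * cmat_mult (pverts G) (cmat_adjoint (boundary_matrix G)) (boundary_matrix G) a b
             - cmat_one a b)"

definition shift_matrix :: "('a \<times> 'a, 'a \<times> 'a) cmat" where
  "shift_matrix = (\<lambda>a b. if a = prod.swap b then 1 else 0)"

definition time_evolution :: "'a pair_pre_digraph \<Rightarrow> ('a \<times> 'a, 'a \<times> 'a) cmat" where
  "time_evolution G = cmat_mult (parcs G) shift_matrix (coin_matrix G)"

definition unit_vec_at :: "'a \<Rightarrow> 'a \<Rightarrow> complex" where
  "unit_vec_at u = (\<lambda>x. if u = x then 1 else 0)"

definition vertex_state :: "'a pair_pre_digraph \<Rightarrow> 'a \<Rightarrow> 'a \<times> 'a \<Rightarrow> complex" where
  "vertex_state G u =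
    cmat_vec (pverts G) (cmat_adjoint (boundary_matrix G)) (unit_vec_at u)"

definition pst_at :: "'a pair_pre_digraph \<Rightarrow> 'a \<Rightarrow> 'a \<Rightarrow> nat \<Rightarrow> bool" where
  "pst_at G u v \<tau> \<longleftrightarrow>
    (\<exists>\<gamma>::complex. cmod \<gamma> = 1 \<and>
      (\<forall>a\<in>parcs G. cmat_vec (parcs G) (cmat_pow (parcs G) (time_evolution G) \<tau>) (vertex_state G u) a
                     = \<gamma> * vertex_state G v a))"

definition exhibits_pst :: "'a pair_pre_digraph \<Rightarrow> bool" where
  "exhibits_pst G \<longleftrightarrow>
    (\<exists>u\<in>pverts G. \<exists>v\<in>pverts G. u \<noteq> v \<and> (\<exists>\<tau>>0. pst_at G u v \<tau>))"

section \<open>Quadratic unitary Cayley graphs\<close>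

definition unit_squares :: "nat \<Rightarrow> int set" where
  "unit_squares n = (let Z = residue_ring (int n) in {r [^]\<^bsub>Z\<^esub> (2::nat) | r. r \<in> Units Z})"

definition quad_connection_set :: "nat \<Rightarrow> int set" where
  "quad_connection_set n =
    unit_squares n \<union> (\<lambda>x. \<ominus>\<^bsub>residue_ring (int n)\<^esub> x) ` unit_squares n"

definition quad_unitary_cayley :: "nat \<Rightarrow> int pair_pre_digraph" where
  "quad_unitary_cayley n =
    (let Z = residue_ring (int n) in
      \<lparr>pverts = carrier Z,
       parcs = {(u, v). u \<in> carrier Z \<and> v \<in> carrier Z \<and> u \<ominus>\<^bsub>Z\<^esub> v \<in> quad_connection_set n}\<rparr>)"

text \<open>
  For \<open>n \<ge> 2\<close> these graphs are finite, simple and connected, so the Grover walk on them is defined.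
\<close>

lemma pair_graph_quad_unitary_cayley:
  assumes "n \<ge> 2"
  shows "pair_graph (quad_unitary_cayley n)"
proof -
  define Z where "Z = residue_ring (int n)"
  interpret residues "int n" Z
    using assms by unfold_locales (auto simp: Z_def)
  have fin: "finite (carrier Z)"
    by (simp add: Z_def residue_ring_def)
  have sq: "unit_squares n \<subseteq> Units Z"
    by (auto simp: unit_squares_def Let_def Z_def[symmetric] intro: Units_pow_closed)
  have neg: "\<ominus>\<^bsub>Z\<^esub> x \<in> Units Z" if "x \<in> Units Z" for x
    using that by (rule Units_minus_one_closed[THEN Units_m_closed, THEN back_subst[where P = "\<lambda>y. y \<in> Units Z"]])
      (use that in \<open>simp add: l_minus Units_closed\<close>)
  have conn: "quad_connection_set n \<subseteq> Units Z"
    using sq neg by (auto simp: quad_connection_set_def Z_def[symmetric])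
  have zero: "\<zero>\<^bsub>Z\<^esub> \<notin> quad_connection_set n"
    using conn by (auto simp: res_units_eq res_zero_eq)
  have sym: "\<ominus>\<^bsub>Z\<^esub> x \<in> quad_connection_set n" if "x \<in> quad_connection_set n" for x
    using that sq by (auto simp: quad_connection_set_def Z_def[symmetric] Units_closed subset_iff)
  have arcs: "parcs (quad_unitary_cayley n) =
      {(u, v). u \<in> carrier Z \<and> v \<in> carrier Z \<and> u \<ominus>\<^bsub>Z\<^esub> v \<in> quad_connection_set n}"
    and verts: "pverts (quad_unitary_cayley n) = carrier Z"
    by (simp_all add: quad_unitary_cayley_def Z_def Let_def)
  have "finite (parcs (quad_unitary_cayley n))"
    by (rule finite_subset[of _ "carrier Z \<times> carrier Z"]) (auto simp: arcs fin)
  moreover have "v \<ominus>\<^bsub>Z\<^esub> u \<in> quad_connection_set n"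
    if "u \<ominus>\<^bsub>Z\<^esub> v \<in> quad_connection_set n" "u \<in> carrier Z" "v \<in> carrier Z" for u v
    using sym[OF that(1)] that(2,3) by (simp add: a_minus_def minus_add a_comm)
  moreover have "u \<ominus>\<^bsub>Z\<^esub> u \<notin> quad_connection_set n" if "u \<in> carrier Z" for u
    using zero that by (simp add: a_minus_def r_neg)
  ultimately show ?thesis
    by unfold_locales
      (auto simp: arcs verts fin symmetric_def sym_def)
qed

lemma connected_quad_unitary_cayley:
  assumes "n \<ge> 2"
  shows "connected (with_proj (quad_unitary_cayley n))"
proof -
  let ?G = "quad_unitary_cayley n"
  define Z where "Z = residue_ring (int n)"
  interpret residues "int n" Z
    using assms by unfold_locales (auto simp: Z_def)
  interpret pair_graph ?G
    by (rule pair_graph_quad_unitary_cayley[OF assms])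
  have verts: "pverts ?G = {0..int n - 1}"
    by (simp add: quad_unitary_cayley_def Let_def residue_ring_def)
  have "\<one>\<^bsub>Z\<^esub> \<in> unit_squares n"
    by (auto simp: unit_squares_def Let_def Z_def[symmetric] intro!: exI[of _ "\<one>\<^bsub>Z\<^esub>"])
  then have one: "1 \<in> quad_connection_set n"
    by (simp add: quad_connection_set_def Z_def residue_ring_def)
  have arc: "(int k + 1, int k) \<in> parcs ?G" if "Suc k < n" for k
  proof -
    have "(int k + 1) \<ominus>\<^bsub>Z\<^esub> int k = ((int k + 1) + (- int k) mod int n) mod int n"
      by (simp add: a_minus_def res_neg_eq res_add_eq)
    also have "\<dots> = 1"
      using assms by (simp add: mod_add_right_eq)
    finally show ?thesis
      using one that by (simp add: quad_unitary_cayley_def Let_def Z_def residue_ring_def)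
  qed
  have reach: "int k \<rightarrow>\<^sup>*\<^bsub>with_proj ?G\<^esub> 0 \<and> 0 \<rightarrow>\<^sup>*\<^bsub>with_proj ?G\<^esub> int k" if "k < n" for k
    using that
  proof (induction k)
    case 0
    then show ?case
      using assms by (auto simp: verts)
  next
    case (Suc k)
    have "(int k, int k + 1) \<in> parcs ?G"
      using arc[OF Suc.prems] pair_sym_arcs by (auto simp: symmetric_def sym_def)
    moreover have "int k \<rightarrow>\<^sup>*\<^bsub>with_proj ?G\<^esub> 0" "0 \<rightarrow>\<^sup>*\<^bsub>with_proj ?G\<^esub> int k"
      using Suc by auto
    ultimately show ?case
      using arc[OF Suc.prems]
      by (auto simp: add.commute intro: adj_reachable_trans reachable_adj_trans)
  qed
  show ?thesis
  proof (unfold connected_def, rule strongly_connectedI)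
    show "verts (with_proj (mk_symmetric (with_proj ?G))) \<noteq> {}"
      using assms by (simp add: verts)
    fix u v
    assume "u \<in> verts (with_proj (mk_symmetric (with_proj ?G)))"
      and "v \<in> verts (with_proj (mk_symmetric (with_proj ?G)))"
    then have "u = int (nat u)" "nat u < n" "v = int (nat v)" "nat v < n"
      using assms by (auto simp: verts)
    then have "u \<rightarrow>\<^sup>*\<^bsub>with_proj ?G\<^esub> v"
      using reach[of "nat u"] reach[of "nat v"] by (metis reachable_trans)
    then show "u \<rightarrow>\<^sup>*\<^bsub>with_proj (mk_symmetric (with_proj ?G))\<^esub> v"
      by (rule reachable_mk_symmetricI)
  qed
qed

end

theory Submission
  imports
    Defs
    "Jordan_Normal_Form.Char_Poly"
begin

text \<open>
  On a regular graph the Grover walk acts on the eigenspace of the normalised adjacency matrix for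
  the eigenvalue \<open>cos \<theta>\<close> through the Chebyshev polynomials. For a circulant graph the eigenvectors are
  characters, and comparing them at the two vertices shows that perfect state transfer at time
  \<open>\<tau>\<close> means that \<open>n\<close> is even and \<open>cos (\<tau> * \<theta>\<^sub>j) = (-1)\<^sup>j\<close> for all \<open>j\<close>.

  Then each \<open>2 * cos \<theta>\<^sub>j\<close> is a sum of two roots of unity, so rational numbers that are polynomials in
  these values with integer coefficients are integers. The eigenvalues for a divisor \<open>m\<close> of \<open>n\<close> occur
  among those for \<open>n\<close>; taking for \<open>m\<close> a prime, \<open>15\<close> and \<open>40\<close>, integrality leaves only the prime
  divisors \<open>2\<close>, \<open>3\<close>, \<open>5\<close> and excludes multiples of \<open>15\<close> and \<open>40\<close>. Odd prime squares and \<open>16\<close> are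
  excluded because the eigenvalue \<open>0\<close> occurs. Of the remaining \<open>n\<close>, all but \<open>20\<close> give cycles
  (or a single edge).
\<close>

section \<open>Integrality\<close>

text \<open>The multipliers of the Z-module M spanned by \<open>b 0, ..., b (N - 1)\<close>: all
  \<open>y\<close> with \<open>y * M\<close> inside M. Sums and products of multipliers correspond
  to sums and products of integer matrices, so integrality carries over to polynomial expressions in
  several of them.\<close>

definition stabilizer_ring :: "nat \<Rightarrow> (nat \<Rightarrow> complex) \<Rightarrow> complex set" where
  "stabilizer_ring N b =
    {y. \<exists>c :: nat \<Rightarrow> nat \<Rightarrow> int. \<forall>i<N. y * b i = (\<Sum>k<N. of_int (c i k) * b k)}"

lemma stabilizer_ringI:
  "(\<And>i. i < N \<Longrightarrow> y * b i = (\<Sum>k<N. of_int (c i k) * b k)) \<Longrightarrow> y \<in> stabilizer_ring N b"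
  unfolding stabilizer_ring_def by blast

lemma stabilizer_ring_add:
  assumes "x \<in> stabilizer_ring N b" "y \<in> stabilizer_ring N b"
  shows "x + y \<in> stabilizer_ring N b"
proof -
  obtain c d :: "nat \<Rightarrow> nat \<Rightarrow> int" where
    "\<forall>i<N. x * b i = (\<Sum>k<N. of_int (c i k) * b k)" "\<forall>i<N. y * b i = (\<Sum>k<N. of_int (d i k) * b k)"
    using assms unfolding stabilizer_ring_def by blast
  then show ?thesis
    by (intro stabilizer_ringI[where c = "\<lambda>i k. c i k + d i k"])
      (simp add: algebra_simps sum.distrib)
qed

lemma stabilizer_ring_0: "0 \<in> stabilizer_ring N b"
  by (rule stabilizer_ringI[where c = "\<lambda>i k. 0"]) simp

lemma stabilizer_ring_mult:
  assumes "x \<in> stabilizer_ring N b" "y \<in> stabilizer_ring N b"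
  shows "x * y \<in> stabilizer_ring N b"
proof -
  obtain c d :: "nat \<Rightarrow> nat \<Rightarrow> int" where
    c: "\<And>i. i < N \<Longrightarrow> x * b i = (\<Sum>k<N. of_int (c i k) * b k)" and
    d: "\<And>i. i < N \<Longrightarrow> y * b i = (\<Sum>k<N. of_int (d i k) * b k)"
    using assms unfolding stabilizer_ring_def by blast
  have "x * y * b i = (\<Sum>k<N. of_int (\<Sum>l<N. d i l * c l k) * b k)" if "i < N" for i
  proof -
    have "x * y * b i = (\<Sum>l<N. of_int (d i l) * (x * b l))"
      by (simp add: d[OF that] sum_distrib_left mult_ac)
    also have "\<dots> = (\<Sum>l<N. \<Sum>k<N. of_int (d i l * c l k) * b k)"
      by (simp add: c sum_distrib_left mult_ac)
    also have "\<dots> = (\<Sum>k<N. \<Sum>l<N. of_int (d i l * c l k) * b k)"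
      by (rule sum.swap)
    finally show ?thesis
      by (simp add: sum_distrib_right)
  qed
  then show ?thesis
    by (rule stabilizer_ringI)
qed

lemma stabilizer_ring_sum:
  assumes "\<And>j. j \<in> A \<Longrightarrow> f j \<in> stabilizer_ring N b"
  shows "(\<Sum>j\<in>A. f j) \<in> stabilizer_ring N b"
  using assms
  by (induction A rule: infinite_finite_induct) (auto intro: stabilizer_ring_0 stabilizer_ring_add)

text \<open>An element of the ring is an eigenvalue of the integer matrix by which it acts on \<open>b\<close>.\<close>

lemma algebraic_int_stabilizer_ring:
  assumes "y \<in> stabilizer_ring N b" "i < N" "b i \<noteq> 0"
  shows "algebraic_int y"
proof -
  obtain c :: "nat \<Rightarrow> nat \<Rightarrow> int" where
    c: "\<And>i. i < N \<Longrightarrow> y * b i = (\<Sum>k<N. of_int (c i k) * b k)"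
    using assms(1) unfolding stabilizer_ring_def by blast
  define A where "A = mat N N (\<lambda>(i, k). c i k)"
  define B :: "complex mat" where "B = map_mat of_int A"
  have A: "A \<in> carrier_mat N N" and B: "B \<in> carrier_mat N N"
    by (simp_all add: A_def B_def)
  have "B *\<^sub>v vec N b = y \<cdot>\<^sub>v vec N b"
    by (rule eq_vecI)
      (simp_all add: A_def B_def c scalar_prod_def row_def lessThan_atLeast0)
  moreover have "vec N b \<noteq> 0\<^sub>v N"
    using assms(2,3) by (metis index_vec index_zero_vec(1))
  ultimately have "eigenvalue B y"
    using B unfolding eigenvalue_def eigenvector_def by (intro exI[of _ "vec N b"]) auto
  then have "poly (char_poly B) y = 0"
    using eigenvalue_root_char_poly[OF B] by simp
  moreover have "char_poly B = map_poly of_int (char_poly A)"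
    unfolding B_def using of_int_hom.char_poly_hom[OF A] .
  moreover have "lead_coeff (char_poly A) = 1"
    using degree_monic_char_poly[OF A] by simp
  ultimately show ?thesis
    unfolding algebraic_int_altdef_ipoly by auto
qed

section \<open>The Grover walk on a regular graph\<close>

locale regular_pair_graph = pair_graph G for G :: "'a pair_pre_digraph" +
  fixes d :: nat
  assumes deg_pos: "d > 0"
    and regular: "\<And>x. x \<in> pverts G \<Longrightarrow> out_degree (with_proj G) x = d"
begin

text \<open>The tails of the arcs into \<open>x\<close>: the coin mixes arcs with a common terminus,
  so one step of the walk sums over this set.\<close>

definition nbrs :: "'a \<Rightarrow> 'a set" where
  "nbrs x = {z. (z, x) \<in> parcs G}"

lemma finite_nbrs [simp]: "finite (nbrs x)"
  by (rule finite_subset[of _ "pverts G"]) (auto simp: nbrs_def dest: in_arcsD1 in_arcsD2)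

lemma arc_sym: "(x, y) \<in> parcs G \<Longrightarrow> (y, x) \<in> parcs G"
  using pair_sym_arcs by (auto simp: symmetric_def sym_def)

lemma arc_sym_iff: "(x, y) \<in> parcs G \<longleftrightarrow> (y, x) \<in> parcs G"
  using arc_sym by blast

lemma card_nbrs: "x \<in> pverts G \<Longrightarrow> card (nbrs x) = d"
proof -
  assume x: "x \<in> pverts G"
  have "out_arcs (with_proj G) x = Pair x ` nbrs x"
    by (auto simp: out_arcs_def nbrs_def arc_sym_iff)
  then show ?thesis
    using regular[OF x] by (simp add: out_degree_def card_image inj_on_def)
qed

lemma sum_arcs:
  fixes f :: "'a \<times> 'a \<Rightarrow> 'b :: comm_monoid_add"
  shows "(\<Sum>a\<in>parcs G. f a) = (\<Sum>y\<in>pverts G. \<Sum>x\<in>nbrs y. f (x, y))"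
proof -
  have "(\<Sum>y\<in>pverts G. \<Sum>x\<in>nbrs y. f (x, y)) = (\<Sum>(y, x)\<in>(SIGMA y:pverts G. nbrs y). f (x, y))"
    by (rule sum.Sigma) auto
  also have "\<dots> = (\<Sum>a\<in>parcs G. f a)"
    by (rule sum.reindex_bij_witness[of _ prod.swap prod.swap])
      (auto simp: nbrs_def dest: in_arcsD2)
  finally show ?thesis ..
qed

lemma sum_arcs_swap:
  fixes f :: "'a \<times> 'a \<Rightarrow> 'b :: comm_monoid_add"
  shows "(\<Sum>a\<in>parcs G. f a) = (\<Sum>a\<in>parcs G. f (prod.swap a))"
  by (rule sum.reindex_bij_witness[of _ prod.swap prod.swap]) (auto intro: arc_sym)

text \<open>By regularity \<open>N^* N\<close> has the entry \<open>1 / d\<close> exactly at pairs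
  of arcs with the same terminus, so the coin is the Grover diffusion on each such block.\<close>

lemma coin_matrix_eq:
  assumes "a \<in> parcs G" "b \<in> parcs G"
  shows "coin_matrix G a b = (if snd a = snd b then 2 / of_nat d else 0) - (if a = b then 1 else 0)"
proof -
  have s: "snd a \<in> pverts G" "snd b \<in> pverts G"
    using assms by (auto dest: in_arcsD1 in_arcsD2)
  have sq: "complex_of_real (sqrt d) * complex_of_real (sqrt d) = of_nat d"
    by (metis abs_of_nat of_real_mult of_real_of_nat_eq real_sqrt_mult_self)
  have "cmat_mult (pverts G) (cmat_adjoint (boundary_matrix G)) (boundary_matrix G) a b =
    (\<Sum>x\<in>pverts G. if x = snd a then (if snd a = snd b then 1 / of_nat d else 0) else 0)"
    unfolding cmat_mult_def cmat_adjoint_def boundary_matrix_def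
    by (intro sum.cong refl) (auto simp: regular sq)
  also have "\<dots> = (if snd a = snd b then 1 / of_nat d else 0)"
    using s by simp
  finally show ?thesis
    by (simp add: coin_matrix_def cmat_one_def)
qed

definition evolve :: "('a \<times> 'a \<Rightarrow> complex) \<Rightarrow> 'a \<times> 'a \<Rightarrow> complex" where
  "evolve = cmat_vec (parcs G) (time_evolution G)"

text \<open>The shift reads the coin output at the reversed arc \<open>(y, x)\<close>, whose block
  consists of the arcs into \<open>x\<close>.\<close>

lemma evolve_eq:
  assumes "(x, y) \<in> parcs G"
  shows "evolve w (x, y) = 2 / of_nat d * (\<Sum>z\<in>nbrs x. w (z, x)) - w (y, x)"
proof -
  have yx: "(y, x) \<in> parcs G" and x: "x \<in> pverts G"
    using assms arc_sym by (auto dest: in_arcsD1 in_arcsD2)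
  have T: "time_evolution G (x, y) b = coin_matrix G (y, x) b" for b
  proof -
    have "time_evolution G (x, y) b =
      (\<Sum>c\<in>parcs G. if c = (y, x) then coin_matrix G (y, x) b else 0)"
      unfolding time_evolution_def cmat_mult_def shift_matrix_def
      by (intro sum.cong refl) auto
    then show ?thesis
      using yx by simp
  qed
  have "evolve w (x, y) = (\<Sum>b\<in>parcs G. coin_matrix G (y, x) b * w b)"
    by (simp add: evolve_def cmat_vec_def T)
  also have "\<dots> = (\<Sum>b\<in>parcs G. (if snd b = x then 2 / of_nat d * w b else 0)
      - (if b = (y, x) then w b else 0))"
    by (intro sum.cong refl) (auto simp: coin_matrix_eq[OF yx] algebra_simps)
  also have "\<dots> = (\<Sum>b\<in>parcs G. if snd b = x then 2 / of_nat d * w b else 0) - w (y, x)"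
    using yx by (simp add: sum_subtractf)
  also have "(\<Sum>b\<in>parcs G. if snd b = x then 2 / of_nat d * w b else 0) =
      (\<Sum>v\<in>pverts G. if v = x then (\<Sum>z\<in>nbrs v. 2 / of_nat d * w (z, v)) else 0)"
    unfolding sum_arcs by (intro sum.cong refl) auto
  also have "\<dots> = 2 / of_nat d * (\<Sum>z\<in>nbrs x. w (z, x))"
    using x by (simp add: sum_distrib_left)
  finally show ?thesis .
qed

text \<open>Passes from matrix powers to iterates of \<open>evolve\<close>. It is confined to arcs
  because the identity matrix, applied by summation over the arc set, gives 0 elsewhere.\<close>

lemma cmat_pow_evolve:
  assumes "a \<in> parcs G"
  shows "cmat_vec (parcs G) (cmat_pow (parcs G) (time_evolution G) k) w a = (evolve ^^ k) w a"
using assms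
proof (induction k arbitrary: a)
  case 0
  have "cmat_vec (parcs G) cmat_one w a = (\<Sum>b\<in>parcs G. if b = a then w a else 0)"
    unfolding cmat_vec_def cmat_one_def by (intro sum.cong refl) auto
  then show ?case
    using 0 by simp
next
  case (Suc k)
  have ev: "evolve f a = (\<Sum>b\<in>parcs G. time_evolution G a b * f b)" for f
    by (simp add: evolve_def cmat_vec_def)
  have "cmat_vec (parcs G) (cmat_pow (parcs G) (time_evolution G) (Suc k)) w a =
    (\<Sum>b\<in>parcs G. time_evolution G a b *
      cmat_vec (parcs G) (cmat_pow (parcs G) (time_evolution G) k) w b)"
    unfolding cmat_vec_def cmat_mult_def cmat_pow.simps
      sum_distrib_left sum_distrib_right mult.assoc
    by (rule sum.swap)
  also have "\<dots> = evolve ((evolve ^^ k) w) a"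
    unfolding ev by (intro sum.cong refl) (simp only: Suc.IH)
  finally show ?case
    by simp
qed

lemma vertex_state_eq:
  assumes "u \<in> pverts G" "(x, y) \<in> parcs G"
  shows "vertex_state G u (x, y) = (if y = u then complex_of_real (1 / sqrt d) else 0)"
proof -
  have "vertex_state G u (x, y) =
    (\<Sum>v\<in>pverts G. if v = u then (if y = u then complex_of_real (1 / sqrt d) else 0) else 0)"
    unfolding vertex_state_def cmat_vec_def cmat_adjoint_def boundary_matrix_def unit_vec_at_def
    by (intro sum.cong refl) (auto simp: regular)
  then show ?thesis
    using assms by simp
qed

section \<open>Eigenfunctions and their pairing with the walk\<close>

definition eigenfunction :: "('a \<Rightarrow> complex) \<Rightarrow> real \<Rightarrow> bool" where
  "eigenfunction f \<nu> \<longleftrightarrow> (\<forall>x\<in>pverts G. (\<Sum>z\<in>nbrs x. f z) = of_nat d * of_real \<nu> * f x)"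

lemma sum_head:
  fixes f g :: "'a \<Rightarrow> complex"
  assumes "eigenfunction f \<nu>"
  shows "(\<Sum>(x, y)\<in>parcs G. f x * g y) = of_nat d * of_real \<nu> * (\<Sum>y\<in>pverts G. f y * g y)"
proof -
  have "(\<Sum>(x, y)\<in>parcs G. f x * g y) = (\<Sum>y\<in>pverts G. (\<Sum>x\<in>nbrs y. f x) * g y)"
    by (simp add: sum_arcs sum_distrib_right)
  also have "\<dots> = (\<Sum>y\<in>pverts G. of_nat d * of_real \<nu> * (f y * g y))"
    using assms by (intro sum.cong refl) (simp add: eigenfunction_def)
  finally show ?thesis
    by (simp add: sum_distrib_left)
qed

text \<open>
  Pairing the state with an eigenfunction of eigenvalue \<open>d * \<nu>\<close> at the heads and at the tails of the
  arcs turns one step of the walk into the Chebyshev recursion in \<open>\<nu>\<close>.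
\<close>

lemma tail_moment_evolve:
  "(\<Sum>(x, y)\<in>parcs G. f x * evolve w (x, y)) = (\<Sum>(x, y)\<in>parcs G. f y * w (x, y))"
proof -
  have "(\<Sum>(x, y)\<in>parcs G. f x * evolve w (x, y)) =
    (\<Sum>(x, y)\<in>parcs G. f x * (2 / of_nat d * (\<Sum>z\<in>nbrs x. w (z, x))) - f x * w (y, x))"
    by (intro sum.cong refl) (auto simp: evolve_eq algebra_simps)
  also have "\<dots> = (\<Sum>(x, y)\<in>parcs G. f x * (2 / of_nat d * (\<Sum>z\<in>nbrs x. w (z, x))))
      - (\<Sum>(x, y)\<in>parcs G. f x * w (y, x))"
    by (simp add: case_prod_beta sum_subtractf)
  also have "(\<Sum>(x, y)\<in>parcs G. f x * w (y, x)) = (\<Sum>(x, y)\<in>parcs G. f y * w (x, y))"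
    by (subst sum_arcs_swap) (simp add: case_prod_beta)
  \<comment> \<open>The summand depends on \<open>x\<close> only and \<open>d\<close> arcs leave
    \<open>x\<close>, which cancels the denominator of \<open>2 / d\<close>. Twice the head moment
    minus its reflected copy then leaves it once.\<close>
  also have "(\<Sum>(x, y)\<in>parcs G. f x * (2 / of_nat d * (\<Sum>z\<in>nbrs x. w (z, x)))) =
     (\<Sum>x\<in>pverts G. 2 * f x * (\<Sum>z\<in>nbrs x. w (z, x)))"
    using deg_pos
    by (subst sum_arcs_swap) (simp add: case_prod_beta sum_arcs card_nbrs mult_ac)
  also have "\<dots> = 2 * (\<Sum>(x, y)\<in>parcs G. f y * w (x, y))"
    by (simp add: sum_arcs sum_distrib_left mult.assoc)
  finally show ?thesis
    by simp
qed

lemma head_moment_evolve: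
  assumes "eigenfunction f \<nu>"
  shows "(\<Sum>(x, y)\<in>parcs G. f y * evolve w (x, y)) =
    2 * of_real \<nu> * (\<Sum>(x, y)\<in>parcs G. f y * w (x, y)) - (\<Sum>(x, y)\<in>parcs G. f x * w (x, y))"
proof -
  let ?g = "\<lambda>x. \<Sum>z\<in>nbrs x. w (z, x)"
  have "(\<Sum>(x, y)\<in>parcs G. f y * evolve w (x, y)) =
    (\<Sum>(x, y)\<in>parcs G. 2 / of_nat d * (f y * ?g x) - f y * w (y, x))"
    by (intro sum.cong refl) (auto simp: evolve_eq algebra_simps)
  also have "\<dots> = 2 / of_nat d * (\<Sum>(x, y)\<in>parcs G. f y * ?g x)
      - (\<Sum>(x, y)\<in>parcs G. f y * w (y, x))"
    by (simp add: case_prod_beta sum_subtractf sum_distrib_left)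
  also have "(\<Sum>(x, y)\<in>parcs G. f y * w (y, x)) = (\<Sum>(x, y)\<in>parcs G. f x * w (x, y))"
    by (subst sum_arcs_swap) (simp add: case_prod_beta)
  also have "(\<Sum>(x, y)\<in>parcs G. f y * ?g x) = (\<Sum>(x, y)\<in>parcs G. f x * ?g y)"
    by (subst sum_arcs_swap) (simp add: case_prod_beta)
  also have "\<dots> = of_nat d * of_real \<nu> * (\<Sum>y\<in>pverts G. f y * ?g y)"
    by (rule sum_head[OF assms])
  also have "(\<Sum>y\<in>pverts G. f y * ?g y) = (\<Sum>(x, y)\<in>parcs G. f y * w (x, y))"
    by (simp add: sum_arcs sum_distrib_left)
  finally show ?thesis
    using deg_pos by simp
qed

lemma head_moment_vertex_state:
  assumes "u \<in> pverts G"
  shows "(\<Sum>(x, y)\<in>parcs G. f y * vertex_state G u (x, y)) = of_real (sqrt d) * f u"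
proof -
  have "(\<Sum>(x, y)\<in>parcs G. f y * vertex_state G u (x, y)) =
    (\<Sum>(x, y)\<in>parcs G. f y * (if y = u then complex_of_real (1 / sqrt d) else 0))"
    by (intro sum.cong refl) (auto simp: vertex_state_eq[OF assms])
  also have "\<dots> = (\<Sum>y\<in>pverts G. if y = u then of_nat d * (f u / sqrt d) else 0)"
    unfolding sum_arcs by (intro sum.cong refl) (auto simp: card_nbrs)
  also have "\<dots> = of_real (real d / sqrt d) * f u"
    using assms by simp
  also have "real d / sqrt d = sqrt d"
    by (simp add: real_div_sqrt)
  finally show ?thesis .
qed

lemma tail_moment_vertex_state:
  assumes "u \<in> pverts G" "eigenfunction f \<nu>"
  shows "(\<Sum>(x, y)\<in>parcs G. f x * vertex_state G u (x, y)) = of_real \<nu> * of_real (sqrt d) * f u"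
proof -
  let ?g = "\<lambda>y. if y = u then complex_of_real (1 / sqrt d) else 0"
  have "(\<Sum>(x, y)\<in>parcs G. f x * vertex_state G u (x, y)) =
    (\<Sum>(x, y)\<in>parcs G. f x * ?g y)"
    by (intro sum.cong refl) (auto simp: vertex_state_eq[OF assms(1)])
  also have "\<dots> = of_nat d * of_real \<nu> * (\<Sum>y\<in>pverts G. f y * ?g y)"
    by (rule sum_head[OF assms(2)])
  also have "(\<Sum>y\<in>pverts G. f y * ?g y) = f u / sqrt d"
    using assms(1) by (simp add: if_distrib cong: if_cong)
  also have "of_nat d * of_real \<nu> * (f u / sqrt d) = of_real \<nu> * of_real (real d / sqrt d) * f u"
    by simp
  also have "real d / sqrt d = sqrt d"
    by (simp add: real_div_sqrt)
  finally show ?thesis .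
qed

text \<open>The tail moment after a step is the head moment before it, so the head moments satisfy
  \<open>H (k+2) = 2 * cos \<theta> * H (k+1) - H k\<close>. This is the recursion of
  \<open>cos (k * \<theta>)\<close>, and the values at 0 and 1 agree up to the common
  factor.\<close>

lemma head_moment_evolve_funpow:
  assumes "u \<in> pverts G" "eigenfunction f (cos \<theta>)"
  shows "(\<Sum>(x, y)\<in>parcs G. f y * (evolve ^^ k) (vertex_state G u) (x, y)) =
    of_real (cos (real k * \<theta>)) * of_real (sqrt d) * f u"
proof (induction k rule: induct_nat_012)
  case 0
  then show ?case
    by (simp add: head_moment_vertex_state assms)
next
  case 1
  then show ?case
    using assms by (simp add: head_moment_evolve head_moment_vertex_state tail_moment_vertex_state)
next
  case (ge2 k)
  have "(\<Sum>(x, y)\<in>parcs G. f y * (evolve ^^ Suc (Suc k)) (vertex_state G u) (x, y)) =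
    2 * of_real (cos \<theta>) * (of_real (cos (real (Suc k) * \<theta>)) * of_real (sqrt d) * f u)
      - of_real (cos (real k * \<theta>)) * of_real (sqrt d) * f u"
    unfolding ge2[symmetric] funpow.simps(2)[of "Suc k"] comp_def
      head_moment_evolve[OF assms(2)] funpow.simps(2)[of k] tail_moment_evolve
    by simp
  also have "\<dots> = of_real (2 * cos \<theta> * cos (real (Suc k) * \<theta>) - cos (real k * \<theta>)) * of_real (sqrt d) * f u"
    by (simp add: algebra_simps)
  also have "2 * cos \<theta> * cos (real (Suc k) * \<theta>) - cos (real k * \<theta>) = cos (real (Suc (Suc k)) * \<theta>)"
    using cos_add[of "real (Suc k) * \<theta>" \<theta>] cos_diff[of "real (Suc k) * \<theta>" \<theta>]
    by (simp add: algebra_simps)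
  finally show ?case .
qed

text \<open>Both sides of the transfer identity are paired with \<open>f\<close> at the heads, and
  \<open>sqrt d\<close> is cancelled. One phase \<open>\<gamma>\<close> serves all eigenfunctions,
  so these can be compared with each other.\<close>

lemma pst_at_imp_eigenfunctions:
  assumes "pst_at G u v \<tau>" "u \<in> pverts G" "v \<in> pverts G"
  obtains \<gamma> where "\<And>f \<theta>. eigenfunction f (cos \<theta>) \<Longrightarrow> of_real (cos (real \<tau> * \<theta>)) * f u = \<gamma> * f v"
proof -
  obtain \<gamma> where \<gamma>: "\<And>a. a \<in> parcs G \<Longrightarrow> (evolve ^^ \<tau>) (vertex_state G u) a = \<gamma> * vertex_state G v a"
    using assms(1) unfolding pst_at_def by (auto simp: cmat_pow_evolve)
  have "of_real (cos (real \<tau> * \<theta>)) * f u = \<gamma> * f v" if f: "eigenfunction f (cos \<theta>)" for f \<theta>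
  proof -
    have "of_real (cos (real \<tau> * \<theta>)) * of_real (sqrt d) * f u =
      (\<Sum>(x, y)\<in>parcs G. f y * (evolve ^^ \<tau>) (vertex_state G u) (x, y))"
      by (simp only: head_moment_evolve_funpow[OF assms(2) f])
    also have "\<dots> = \<gamma> * (\<Sum>(x, y)\<in>parcs G. f y * vertex_state G v (x, y))"
      unfolding sum_distrib_left by (intro sum.cong refl) (auto simp: \<gamma>)
    also have "\<dots> = \<gamma> * (of_real (sqrt d) * f v)"
      by (simp only: head_moment_vertex_state[OF assms(3)])
    finally have "complex_of_real (sqrt d) * (of_real (cos (real \<tau> * \<theta>)) * f u) =
      complex_of_real (sqrt d) * (\<gamma> * f v)"
      by (simp only: mult_ac)
    then show ?thesis
      using deg_pos by simp
  qed
  then show ?thesis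
    using that by blast
qed

text \<open>
  The sum of \<open>|f x - \<nu> f y|\<^sup>2\<close> over all arcs is \<open>2 * d * (1 - \<nu>\<^sup>2)\<close> times the squared norm of \<open>f\<close>.
\<close>

lemma eigenfunction_extremal:
  assumes "eigenfunction f \<nu>" "\<bar>\<nu>\<bar> = 1" "(x, y) \<in> parcs G"
  shows "f x = of_real \<nu> * f y"
proof -
  have sq: "of_real \<nu> * of_real \<nu> = (1 :: complex)"
    using assms(2) by (metis abs_1 abs_mult_self_eq mult_1 of_real_1 of_real_mult)
  have "complex_of_real (\<Sum>(x, y)\<in>parcs G. (cmod (f x - of_real \<nu> * f y))\<^sup>2) =
    (\<Sum>(x, y)\<in>parcs G. f x * cnj (f x) + f y * cnj (f y)
       - of_real \<nu> * (f x * cnj (f y)) - of_real \<nu> * (f y * cnj (f x)))"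
    unfolding of_real_sum case_prod_beta complex_norm_square
    using sq by (intro sum.cong refl) (simp add: algebra_simps)
  also have "\<dots> = (\<Sum>(x, y)\<in>parcs G. f x * cnj (f x)) + (\<Sum>(x, y)\<in>parcs G. f y * cnj (f y))
       - of_real \<nu> * (\<Sum>(x, y)\<in>parcs G. f x * cnj (f y))
       - of_real \<nu> * (\<Sum>(x, y)\<in>parcs G. f y * cnj (f x))"
    by (simp add: case_prod_beta sum.distrib sum_subtractf sum_distrib_left)
  also have "(\<Sum>(x, y)\<in>parcs G. f y * cnj (f x)) = (\<Sum>(x, y)\<in>parcs G. f x * cnj (f y))"
    by (subst sum_arcs_swap) (simp add: case_prod_beta)
  also have "(\<Sum>(x, y)\<in>parcs G. f x * cnj (f x)) = (\<Sum>(x, y)\<in>parcs G. f y * cnj (f y))"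
    by (subst sum_arcs_swap) (simp add: case_prod_beta)
  also have "(\<Sum>(x, y)\<in>parcs G. f y * cnj (f y)) = of_nat d * (\<Sum>y\<in>pverts G. f y * cnj (f y))"
    by (simp add: sum_arcs card_nbrs sum_distrib_left)
  also have "(\<Sum>(x, y)\<in>parcs G. f x * cnj (f y)) =
      of_nat d * of_real \<nu> * (\<Sum>y\<in>pverts G. f y * cnj (f y))"
    by (rule sum_head[OF assms(1)])
  also have "of_nat d * (\<Sum>y\<in>pverts G. f y * cnj (f y)) + of_nat d * (\<Sum>y\<in>pverts G. f y * cnj (f y))
     - of_real \<nu> * (of_nat d * of_real \<nu> * (\<Sum>y\<in>pverts G. f y * cnj (f y)))
     - of_real \<nu> * (of_nat d * of_real \<nu> * (\<Sum>y\<in>pverts G. f y * cnj (f y)))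
     = 2 * of_nat d * (\<Sum>y\<in>pverts G. f y * cnj (f y)) * (1 - of_real \<nu> * of_real \<nu>)"
    by (simp add: algebra_simps)
  also have "\<dots> = 0"
    using sq by simp
  finally have "(\<Sum>(x, y)\<in>parcs G. (cmod (f x - of_real \<nu> * f y))\<^sup>2) = 0"
    by (simp only: of_real_eq_0_iff)
  then have "(cmod (f x - of_real \<nu> * f y))\<^sup>2 = 0"
    using assms(3) by (subst (asm) sum_nonneg_eq_0_iff) auto
  then show ?thesis
    by simp
qed

end

text \<open>Chebyshev polynomials of the second kind, shifted by one: \<open>cheb \<nu> k\<close> is \<open>U\<close> of index \<open>k - 1\<close>.\<close>

fun cheb :: "real \<Rightarrow> nat \<Rightarrow> real" where
  "cheb \<nu> 0 = 0"
| "cheb \<nu> (Suc 0) = 1"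
| "cheb \<nu> (Suc (Suc k)) = 2 * \<nu> * cheb \<nu> (Suc k) - cheb \<nu> k"

lemma cheb_sin: "cheb (cos \<theta>) k * sin \<theta> = sin (real k * \<theta>)"
proof (induction k rule: induct_nat_012)
  case (ge2 k)
  have "cheb (cos \<theta>) (Suc (Suc k)) * sin \<theta> =
      2 * cos \<theta> * (cheb (cos \<theta>) (Suc k) * sin \<theta>) - cheb (cos \<theta>) k * sin \<theta>"
    by (simp add: algebra_simps)
  also have "\<dots> = sin (real (Suc (Suc k)) * \<theta>)"
    unfolding ge2 using sin_add[of "real (Suc k) * \<theta>" \<theta>] sin_diff[of "real (Suc k) * \<theta>" \<theta>]
    by (simp add: algebra_simps)
  finally show ?case .
qed simp_all

text \<open>The relation T_{k+1} = x U_k - U_{k-1} between the Chebyshev polynomials of the two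
  kinds at \<open>x = cos \<theta>\<close>.\<close>

lemma cheb_cos: "cos \<theta> * cheb (cos \<theta>) (Suc k) - cheb (cos \<theta>) k = cos (real (Suc k) * \<theta>)"
proof (induction k rule: induct_nat_012)
  case 1
  then show ?case
    using cos_double_cos[of \<theta>] by (simp add: power2_eq_square)
next
  case (ge2 k)
  let ?c = "cheb (cos \<theta>)"
  have "cos \<theta> * ?c (Suc (Suc (Suc k))) - ?c (Suc (Suc k)) =
     2 * cos \<theta> * (cos \<theta> * ?c (Suc (Suc k)) - ?c (Suc k)) - (cos \<theta> * ?c (Suc k) - ?c k)"
    by (simp add: algebra_simps)
  also have "\<dots> = cos (real (Suc (Suc (Suc k))) * \<theta>)"
    unfolding ge2
    using cos_add[of "real (Suc (Suc k)) * \<theta>" \<theta>] cos_diff[of "real (Suc (Suc k)) * \<theta>" \<theta>]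
    by (simp add: algebra_simps)
  finally show ?case .
qed simp

section \<open>Closed form of the evolved state and a sufficient condition for transfer\<close>

context regular_pair_graph
begin

text \<open>The point mass at \<open>u\<close> is expanded into eigenfunctions. In one step the sum
  over \<open>nbrs x\<close> turns \<open>f j z\<close> into \<open>d * \<nu> j * f j x\<close> and
  the reflected term swaps \<open>x\<close> and \<open>y\<close>, which gives the recursion of
  \<open>cheb\<close>. The exponent starts at 1 since time 0 would need \<open>cheb\<close> at index
  -1.\<close>

lemma evolve_funpow_vertex_state:
  fixes f :: "'j \<Rightarrow> 'a \<Rightarrow> complex"
  assumes J: "finite J"
    and eig: "\<And>j. j \<in> J \<Longrightarrow> eigenfunction (f j) (\<nu> j)"
    and u: "u \<in> pverts G" "\<And>x. x \<in> pverts G \<Longrightarrow> (\<Sum>j\<in>J. f j x) = (if x = u then 1 else 0)"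
    and xy: "(x, y) \<in> parcs G"
  shows "(evolve ^^ Suc k) (vertex_state G u) (x, y) =
    1 / sqrt d * (\<Sum>j\<in>J. of_real (cheb (\<nu> j) (Suc k)) * f j x - of_real (cheb (\<nu> j) k) * f j y)"
  using xy
proof (induction k arbitrary: x y)
  case 0
  then have yx: "(y, x) \<in> parcs G" and x: "x \<in> pverts G"
    using arc_sym by (auto dest: in_arcsD1 in_arcsD2)
  have "(\<Sum>z\<in>nbrs x. vertex_state G u (z, x)) = (\<Sum>z\<in>nbrs x. if x = u then complex_of_real (1 / sqrt d) else 0)"
    by (intro sum.cong refl) (auto simp: vertex_state_eq u(1) nbrs_def)
  then show ?case
    using u(2)[OF x] x deg_pos
    by (simp add: evolve_eq[OF 0] vertex_state_eq[OF u(1) yx] card_nbrs)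
next
  case (Suc k)
  then have yx: "(y, x) \<in> parcs G" and x: "x \<in> pverts G"
    using arc_sym by (auto dest: in_arcsD1 in_arcsD2)
  let ?a = "\<lambda>j. complex_of_real (cheb (\<nu> j) (Suc k))" and ?b = "\<lambda>j. complex_of_real (cheb (\<nu> j) k)"
  have "(\<Sum>z\<in>nbrs x. (evolve ^^ Suc k) (vertex_state G u) (z, x)) =
    (\<Sum>z\<in>nbrs x. 1 / sqrt d * (\<Sum>j\<in>J. ?a j * f j z - ?b j * f j x))"
    by (intro sum.cong refl Suc.IH) (simp add: nbrs_def)
  also have "\<dots> = 1 / sqrt d * (\<Sum>j\<in>J. \<Sum>z\<in>nbrs x. ?a j * f j z - ?b j * f j x)"
    by (subst sum.swap) (simp add: sum_distrib_left)
  also have "(\<Sum>j\<in>J. \<Sum>z\<in>nbrs x. ?a j * f j z - ?b j * f j x) =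
      (\<Sum>j\<in>J. ?a j * (\<Sum>z\<in>nbrs x. f j z) - of_nat d * (?b j * f j x))"
    using x by (simp add: sum_subtractf sum_distrib_left card_nbrs)
  also have "\<dots> = of_nat d * (\<Sum>j\<in>J. (?a j * of_real (\<nu> j) - ?b j) * f j x)"
    unfolding sum_distrib_left[of _ _ J]
    using eig x by (intro sum.cong refl) (simp add: eigenfunction_def algebra_simps)
  finally have nb: "(\<Sum>z\<in>nbrs x. (evolve ^^ Suc k) (vertex_state G u) (z, x)) =
    1 / sqrt d * (of_nat d * (\<Sum>j\<in>J. (?a j * of_real (\<nu> j) - ?b j) * f j x))" .
  have "(evolve ^^ Suc (Suc k)) (vertex_state G u) (x, y) =
    2 / of_nat d * (1 / sqrt d * (of_nat d * (\<Sum>j\<in>J. (?a j * of_real (\<nu> j) - ?b j) * f j x)))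
      - 1 / sqrt d * (\<Sum>j\<in>J. ?a j * f j y - ?b j * f j x)"
    unfolding funpow.simps(2)[of "Suc k"] comp_def evolve_eq[OF Suc.prems] nb Suc.IH[OF yx] by simp
  also have "\<dots> = 1 / sqrt d * (2 * (\<Sum>j\<in>J. (?a j * of_real (\<nu> j) - ?b j) * f j x)
      - (\<Sum>j\<in>J. ?a j * f j y - ?b j * f j x))"
    using deg_pos by (simp add: algebra_simps)
  also have "2 * (\<Sum>j\<in>J. (?a j * of_real (\<nu> j) - ?b j) * f j x)
      - (\<Sum>j\<in>J. ?a j * f j y - ?b j * f j x) =
      (\<Sum>j\<in>J. of_real (cheb (\<nu> j) (Suc (Suc k))) * f j x - ?a j * f j y)"
    unfolding sum_distrib_left sum_subtractf[symmetric]
    by (intro sum.cong refl) (simp add: algebra_simps)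
  finally show ?case .
qed

text \<open>When \<open>cos (\<tau> * \<theta> j)\<close> is 1 or -1, its sine vanishes and each
  summand of the evolved state depends on the head of the arc only. What remains is the point mass
  at \<open>v\<close>, read at the head.\<close>

lemma pst_atI_eigenfunctions:
  fixes f :: "'j \<Rightarrow> 'a \<Rightarrow> complex"
  assumes J: "finite J"
    and eig: "\<And>j. j \<in> J \<Longrightarrow> eigenfunction (f j) (cos (\<theta> j))"
    and u: "u \<in> pverts G" "\<And>x. x \<in> pverts G \<Longrightarrow> (\<Sum>j\<in>J. f j x) = (if x = u then 1 else 0)"
    and v: "v \<in> pverts G"
      "\<And>x. x \<in> pverts G \<Longrightarrow> (\<Sum>j\<in>J. of_real (cos (real \<tau> * \<theta> j)) * f j x) = (if x = v then 1 else 0)"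
    and \<tau>: "\<tau> > 0" "\<And>j. j \<in> J \<Longrightarrow> \<bar>cos (real \<tau> * \<theta> j)\<bar> = 1"
  shows "pst_at G u v \<tau>"
proof -
  obtain k where k: "\<tau> = Suc k"
    using \<tau>(1) gr0_conv_Suc by blast
  have "(evolve ^^ \<tau>) (vertex_state G u) (x, y) = vertex_state G v (x, y)" if xy: "(x, y) \<in> parcs G" for x y
  proof -
    have "of_real (cheb (cos (\<theta> j)) (Suc k)) * f j x - of_real (cheb (cos (\<theta> j)) k) * f j y =
        of_real (cos (real \<tau> * \<theta> j)) * f j y" if j: "j \<in> J" for j
    proof (cases "sin (\<theta> j) = 0")
      \<comment> \<open>Here \<open>cheb\<close> need not vanish. The eigenvalue is 1 or -1, and
        extremality expresses the value at the tail through that at the head.\<close>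
      case True
      then have "\<bar>cos (\<theta> j)\<bar> = 1"
        using sin_zero_abs_cos_one by blast
      then have "f j x = of_real (cos (\<theta> j)) * f j y"
        using eigenfunction_extremal[OF eig[OF j] _ xy] by blast
      then show ?thesis
        unfolding k cheb_cos[symmetric] by (simp add: algebra_simps)
    next
      case False
      have "sin (real \<tau> * \<theta> j) = 0"
        using \<tau>(2)[OF j] sin_squared_eq[of "real \<tau> * \<theta> j"] power2_abs[of "cos (real \<tau> * \<theta> j)"]
        by simp
      then have "cheb (cos (\<theta> j)) (Suc k) = 0"
        using cheb_sin[of "\<theta> j" \<tau>] False by (simp add: k)
      then show ?thesis
        unfolding k cheb_cos[symmetric] by simp
    qed
    then have "(evolve ^^ \<tau>) (vertex_state G u) (x, y) =
      1 / sqrt d * (\<Sum>j\<in>J. of_real (cos (real \<tau> * \<theta> j)) * f j y)"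
      unfolding k using evolve_funpow_vertex_state[OF J eig u xy, of k] by (simp add: k)
    also have "\<dots> = vertex_state G v (x, y)"
      using wellformed[OF xy] v by (simp add: vertex_state_eq[OF v(1) xy])
    finally show ?thesis .
  qed
  then show ?thesis
    unfolding pst_at_def by (intro exI[of _ 1]) (auto simp: cmat_pow_evolve)
qed

end

section \<open>Characters and perfect state transfer\<close>

definition echar :: "nat \<Rightarrow> int \<Rightarrow> complex" where
  "echar n k = cis (2 * pi * of_int k / of_nat n)"

lemma echar_add: "echar n (a + b) = echar n a * echar n b"
  by (simp add: echar_def cis_mult add_divide_distrib distrib_left)

lemma echar_0 [simp]: "echar n 0 = 1"
  by (simp add: echar_def)

lemma echar_minus: "echar n (- a) = cnj (echar n a)"
  by (simp add: echar_def cis_cnj)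

lemma echar_power: "echar n a ^ k = echar n (int k * a)"
  by (simp add: echar_def DeMoivre mult_ac)

lemma echar_eq_1_iff:
  assumes "n > 0"
  shows "echar n a = 1 \<longleftrightarrow> int n dvd a"
proof -
  have "echar n a = 1 \<longleftrightarrow> cos (2 * pi * of_int a / of_nat n) = 1"
    unfolding echar_def by (auto simp: complex_eq_iff intro: cos_one_sin_zero)
  also have "\<dots> \<longleftrightarrow> (\<exists>k::int. 2 * pi * of_int a / of_nat n = of_int k * 2 * pi)"
    by (rule cos_one_2pi_int)
  also have "\<dots> \<longleftrightarrow> (\<exists>k::int. real_of_int a = of_int (int n * k))"
    using assms by (intro ex_cong1) (auto simp: field_simps)
  finally show ?thesis
    unfolding of_int_eq_iff dvd_def .
qed

lemma echar_cong:
  assumes "n > 0" "[a = b] (mod int n)"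
  shows "echar n a = echar n b"
proof -
  have "echar n a = echar n (a - b) * echar n b"
    by (simp flip: echar_add)
  then show ?thesis
    using assms by (simp add: echar_eq_1_iff cong_iff_dvd_diff)
qed

lemma sum_echar:
  assumes "n > 0"
  shows "(\<Sum>j<n. echar n (int j * a)) = (if int n dvd a then of_nat n else 0)"
proof (cases "int n dvd a")
  case True
  then have "echar n (int j * a) = 1" for j
    using assms by (simp add: echar_eq_1_iff)
  then show ?thesis
    using True by simp
next
  case False
  then have "echar n a \<noteq> 1"
    using assms by (simp add: echar_eq_1_iff)
  moreover have "(\<Sum>j<n. echar n a ^ j) * (echar n a - 1) = echar n a ^ n - 1"
    by (metis power_diff_1_eq mult.commute)
  moreover have "echar n a ^ n = 1"
    using assms by (simp add: echar_power echar_eq_1_iff)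
  ultimately show ?thesis
    using False by (simp add: echar_power)
qed

text \<open>The root \<open>r\<close> may be any integer coprime to \<open>n\<close>, so later
  constructions of roots need no reduction to a residue.\<close>

lemma mem_quad_connection_set:
  assumes "n \<ge> 2"
  shows "s \<in> quad_connection_set n \<longleftrightarrow> 0 \<le> s \<and> s < int n \<and>
    (\<exists>r. coprime r (int n) \<and> ([s = r\<^sup>2] (mod int n) \<or> [s = - r\<^sup>2] (mod int n)))"
proof -
  define Z where "Z = residue_ring (int n)"
  interpret residues "int n" Z
    using assms by unfold_locales (auto simp: Z_def)
  have sq: "unit_squares n = {r\<^sup>2 mod int n | r. 0 < r \<and> r < int n \<and> coprime r (int n)}"
    unfolding unit_squares_def Let_def Z_def[symmetric] res_units_eq
    by (auto simp: numeral_2_eq_2 res_mult_eq res_one_eq power2_eq_square mod_simps)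
  have "s \<in> quad_connection_set n \<longleftrightarrow>
    (\<exists>r. 0 < r \<and> r < int n \<and> coprime r (int n) \<and> (s = r\<^sup>2 mod int n \<or> s = (- r\<^sup>2) mod int n))"
  proof -
    have "(\<lambda>x. \<ominus>\<^bsub>Z\<^esub> x) ` unit_squares n =
        {(- r\<^sup>2) mod int n | r. 0 < r \<and> r < int n \<and> coprime r (int n)}"
      unfolding sq image_Collect by (simp add: res_neg_eq setcompr_eq_image image_image mod_minus_eq)
    then show ?thesis
      unfolding quad_connection_set_def Z_def[symmetric] sq by auto
  qed
  also have "\<dots> \<longleftrightarrow> 0 \<le> s \<and> s < int n \<and>
    (\<exists>r. coprime r (int n) \<and> ([s = r\<^sup>2] (mod int n) \<or> [s = - r\<^sup>2] (mod int n)))"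
  proof safe
    fix r assume r: "coprime r (int n)" and s: "0 \<le> s" "s < int n"
    have "\<not> int n dvd r"
      using coprime_common_divisor[OF r, of "int n"] assms by auto
    then have "r mod int n \<noteq> 0"
      by (simp add: dvd_eq_mod_eq_0)
    moreover have n: "0 < int n"
      using assms by simp
    ultimately have r': "0 < r mod int n" "r mod int n < int n" "coprime (r mod int n) (int n)"
      using r pos_mod_sign[OF n, of r] pos_mod_bound[OF n, of r] by (linarith, linarith, simp)
    have e: "(r mod int n)\<^sup>2 mod int n = r\<^sup>2 mod int n" "(- (r mod int n)\<^sup>2) mod int n = (- r\<^sup>2) mod int n"
      by (metis power_mod) (metis power_mod mod_minus_eq)
    show "[s = r\<^sup>2] (mod int n) \<Longrightarrow> \<exists>r>0. r < int n \<and> coprime r (int n) \<and>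
        (s = r\<^sup>2 mod int n \<or> s = (- r\<^sup>2) mod int n)"
      using r' e s by (intro exI[of _ "r mod int n"]) (simp add: cong_def)
    show "[s = - r\<^sup>2] (mod int n) \<Longrightarrow> \<exists>r>0. r < int n \<and> coprime r (int n) \<and>
        (s = r\<^sup>2 mod int n \<or> s = (- r\<^sup>2) mod int n)"
      using r' e s by (intro exI[of _ "r mod int n"]) (simp add: cong_def)
  qed (use assms in \<open>auto simp: cong_def\<close>)
  finally show ?thesis .
qed

lemma quad_connection_set_subset: "n \<ge> 2 \<Longrightarrow> quad_connection_set n \<subseteq> {0..<int n}"
  by (auto simp: mem_quad_connection_set)

lemma finite_quad_connection_set [simp]: "n \<ge> 2 \<Longrightarrow> finite (quad_connection_set n)"
  using quad_connection_set_subset finite_subset by blast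

lemma mod_mem_quad_connection_set:
  assumes "n \<ge> 2" "coprime r (int n)"
    "[a = r\<^sup>2] (mod int n) \<or> [a = - r\<^sup>2] (mod int n)"
  shows "a mod int n \<in> quad_connection_set n"
  using assms by (auto simp: mem_quad_connection_set cong_def)

lemma one_mem_quad_connection_set: "n \<ge> 2 \<Longrightarrow> 1 \<in> quad_connection_set n"
  by (auto simp: mem_quad_connection_set intro: exI[of _ 1])

lemma card_quad_connection_set_pos: "n \<ge> 2 \<Longrightarrow> card (quad_connection_set n) > 0"
  using one_mem_quad_connection_set by (auto simp: card_gt_0_iff)

lemma uminus_mem_quad_connection_set:
  assumes "n \<ge> 2" "s \<in> quad_connection_set n"
  shows "(- s) mod int n \<in> quad_connection_set n"
proof -
  obtain r where "coprime r (int n)" "[s = r\<^sup>2] (mod int n) \<or> [s = - r\<^sup>2] (mod int n)"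
    using assms by (auto simp: mem_quad_connection_set)
  moreover from this(2) have "[- s = r\<^sup>2] (mod int n) \<or> [- s = - r\<^sup>2] (mod int n)"
    using cong_minus_minus_iff[of s _ "int n"] by (metis minus_minus)
  ultimately show ?thesis
    using mod_mem_quad_connection_set[OF assms(1)] by blast
qed

lemma pverts_quad_unitary_cayley: "pverts (quad_unitary_cayley n) = {0..<int n}"
  by (auto simp: quad_unitary_cayley_def Let_def residue_ring_def)

lemma parcs_quad_unitary_cayley:
  assumes "n \<ge> 2"
  shows "(u, v) \<in> parcs (quad_unitary_cayley n) \<longleftrightarrow>
    u \<in> {0..<int n} \<and> v \<in> {0..<int n} \<and> (u - v) mod int n \<in> quad_connection_set n"
proof -
  define Z where "Z = residue_ring (int n)"
  interpret residues "int n" Z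
    using assms by unfold_locales (auto simp: Z_def)
  have "u \<ominus>\<^bsub>Z\<^esub> v = (u - v) mod int n"
    by (simp add: a_minus_def res_neg_eq res_add_eq mod_simps)
  moreover have "carrier Z = {0..<int n}"
    by (auto simp: Z_def residue_ring_def)
  ultimately show ?thesis
    by (simp add: quad_unitary_cayley_def Let_def Z_def[symmetric])
qed

lemma inj_on_translate:
  assumes "n \<ge> 2"
  shows "inj_on (\<lambda>s. (x + s) mod int n) (quad_connection_set n)"
    and "inj_on (\<lambda>s. (x - s) mod int n) (quad_connection_set n)"
proof -
  have *: "s = t" if "s \<in> quad_connection_set n" "t \<in> quad_connection_set n" "[s = t] (mod int n)" for s t
    using that quad_connection_set_subset[OF assms] cong_less_imp_eq_int by (metis atLeastLessThan_iff subsetD)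
  show "inj_on (\<lambda>s. (x + s) mod int n) (quad_connection_set n)"
    by (intro inj_onI *) (auto simp flip: cong_def simp: cong_add_lcancel)
  show "inj_on (\<lambda>s. (x - s) mod int n) (quad_connection_set n)"
    by (intro inj_onI *) (auto simp: mod_eq_dvd_iff cong_iff_dvd_diff dvd_diff_commute)
qed

lemma regular_pair_graph_quad_unitary_cayley:
  assumes "n \<ge> 2"
  shows "regular_pair_graph (quad_unitary_cayley n) (card (quad_connection_set n))"
proof -
  interpret pair_graph "quad_unitary_cayley n"
    by (rule pair_graph_quad_unitary_cayley[OF assms])
  show ?thesis
  proof
    show "card (quad_connection_set n) > 0"
      by (rule card_quad_connection_set_pos[OF assms])
    fix x assume "x \<in> pverts (quad_unitary_cayley n)"
    then have x: "x \<in> {0..<int n}"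
      by (simp add: pverts_quad_unitary_cayley)
    have "out_arcs (with_proj (quad_unitary_cayley n)) x = (\<lambda>s. (x, (x - s) mod int n)) ` quad_connection_set n"
    proof safe
      fix a b assume "(a, b) \<in> out_arcs (with_proj (quad_unitary_cayley n)) x"
      then have b: "a = x" "b \<in> {0..<int n}" "(x - b) mod int n \<in> quad_connection_set n"
        using assms by (auto simp: out_arcs_def parcs_quad_unitary_cayley)
      moreover have "b = (x - (x - b) mod int n) mod int n"
        using b(2) by (simp add: mod_simps)
      ultimately show "(a, b) \<in> (\<lambda>s. (x, (x - s) mod int n)) ` quad_connection_set n"
        by blast
    next
      fix s assume "s \<in> quad_connection_set n"
      moreover have "(x - (x - s) mod int n) mod int n = s"
        using calculation quad_connection_set_subset[OF assms] by (auto simp: mod_simps)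
      ultimately show "(x, (x - s) mod int n) \<in> out_arcs (with_proj (quad_unitary_cayley n)) x"
        using x assms by (simp add: out_arcs_def parcs_quad_unitary_cayley)
    qed
    moreover have "inj_on (\<lambda>s. (x, (x - s) mod int n)) (quad_connection_set n)"
      using inj_on_translate(2)[OF assms, of x] by (auto simp: inj_on_def)
    ultimately show "out_degree (with_proj (quad_unitary_cayley n)) x = card (quad_connection_set n)"
      by (simp add: out_degree_def card_image)
  qed
qed

section \<open>Eigenvalues of the Cayley graph and the cosine criterion for transfer\<close>

definition cayley_eigenvalue :: "nat \<Rightarrow> int \<Rightarrow> real" where
  "cayley_eigenvalue n j =
    (\<Sum>s\<in>quad_connection_set n. cos (2 * pi * of_int (j * s) / of_nat n)) / card (quad_connection_set n)"

text \<open>The connection set is closed under negation, so the character sum equals its own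
  conjugate and is determined by its cosines.\<close>

lemma sum_echar_quad_connection_set:
  assumes "n \<ge> 2"
  shows "(\<Sum>s\<in>quad_connection_set n. echar n (j * s)) =
    of_nat (card (quad_connection_set n)) * of_real (cayley_eigenvalue n j)"
proof -
  let ?V = "quad_connection_set n"
  have "(\<Sum>s\<in>?V. echar n (j * s)) = (\<Sum>s\<in>?V. echar n (j * - s))"
  proof (rule sum.reindex_bij_witness[of _ "\<lambda>s. (- s) mod int n" "\<lambda>s. (- s) mod int n"])
    fix s assume s: "s \<in> ?V"
    show "(- ((- s) mod int n)) mod int n = s" "(- ((- s) mod int n)) mod int n = s"
      using s quad_connection_set_subset[OF assms] by (auto simp: mod_minus_eq)
    show "(- s) mod int n \<in> ?V" "(- s) mod int n \<in> ?V"
      using uminus_mem_quad_connection_set[OF assms s] by auto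
    show "echar n (j * - ((- s) mod int n)) = echar n (j * s)"
    proof (rule echar_cong)
      have "[- ((- s) mod int n) = s] (mod int n)"
        using cong_minus_minus_iff[of "(- s) mod int n" "- s" "int n"] by simp
      then show "[j * - ((- s) mod int n) = j * s] (mod int n)"
        by (rule cong_scalar_left)
    qed (use assms in simp)
  qed
  also have "\<dots> = cnj (\<Sum>s\<in>?V. echar n (j * s))"
    by (simp flip: echar_minus)
  finally have "(\<Sum>s\<in>?V. echar n (j * s)) = of_real (Re (\<Sum>s\<in>?V. echar n (j * s)))"
    by (metis Reals_cnj_iff of_real_Re)
  also have "Re (\<Sum>s\<in>?V. echar n (j * s)) = card ?V * cayley_eigenvalue n j"
    using card_quad_connection_set_pos[OF assms] by (simp add: cayley_eigenvalue_def echar_def)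
  finally show ?thesis
    by simp
qed

lemma abs_cayley_eigenvalue_le: "\<bar>cayley_eigenvalue n j\<bar> \<le> 1"
proof -
  have "\<bar>\<Sum>s\<in>quad_connection_set n. cos (2 * pi * of_int (j * s) / of_nat n)\<bar> \<le>
    (\<Sum>s\<in>quad_connection_set n. 1)"
    by (intro order.trans[OF sum_abs] sum_mono) simp
  then show ?thesis
    unfolding cayley_eigenvalue_def by (simp add: divide_le_eq)
qed

lemma cos_arccos_cayley_eigenvalue: "cos (arccos (cayley_eigenvalue n j)) = cayley_eigenvalue n j"
  using abs_cayley_eigenvalue_le[of n j] by (simp add: abs_le_iff)

lemma exhibits_pst_quad_unitary_cayley_iff:
  assumes "n \<ge> 2"
  shows "exhibits_pst (quad_unitary_cayley n) \<longleftrightarrow> even n \<and>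
    (\<exists>\<tau>>0. \<forall>j. cos (real \<tau> * arccos (cayley_eigenvalue n (int j))) = (-1) ^ j)"
proof -
  let ?G = "quad_unitary_cayley n" and ?V = "quad_connection_set n"
  let ?\<theta> = "\<lambda>j. arccos (cayley_eigenvalue n (int j))"
  interpret regular_pair_graph ?G "card ?V"
    by (rule regular_pair_graph_quad_unitary_cayley[OF assms])
  have nbrs: "nbrs x = (\<lambda>s. (x + s) mod int n) ` ?V" if x: "x \<in> {0..<int n}" for x
  proof safe
    fix z assume "z \<in> nbrs x"
    then have z: "z \<in> {0..<int n}" "(z - x) mod int n \<in> ?V"
      using assms by (auto simp: nbrs_def parcs_quad_unitary_cayley)
    moreover have "z = (x + (z - x) mod int n) mod int n"
      using z(1) by (simp add: mod_simps)
    ultimately show "z \<in> (\<lambda>s. (x + s) mod int n) ` ?V"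
      by blast
  next
    fix s assume s: "s \<in> ?V"
    moreover have "((x + s) mod int n - x) mod int n = s"
      using s quad_connection_set_subset[OF assms] by (auto simp: mod_simps)
    ultimately show "(x + s) mod int n \<in> nbrs x"
      using x assms by (simp add: nbrs_def parcs_quad_unitary_cayley)
  qed
  \<comment> \<open>The factor \<open>c\<close> is 1 for necessity and \<open>1 / n\<close> for the
    expansion of a point mass into characters.\<close>
  have eig: "eigenfunction (\<lambda>x. echar n (j * x) * c) (cayley_eigenvalue n j)" for j c
    unfolding eigenfunction_def pverts_quad_unitary_cayley
  proof
    fix x assume x: "x \<in> {0..<int n}"
    have "(\<Sum>z\<in>nbrs x. echar n (j * z) * c) = (\<Sum>s\<in>?V. echar n (j * ((x + s) mod int n)) * c)"
      by (simp add: nbrs[OF x] sum.reindex[OF inj_on_translate(1)[OF assms]])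
    also have "\<dots> = (\<Sum>s\<in>?V. echar n (j * x) * c * echar n (j * s))"
    proof (intro sum.cong refl)
      fix s
      have "echar n (j * ((x + s) mod int n)) = echar n (j * x + j * s)"
        using assms by (intro echar_cong) (auto simp: cong_def mod_simps distrib_left)
      then show "echar n (j * ((x + s) mod int n)) * c = echar n (j * x) * c * echar n (j * s)"
        by (simp add: echar_add)
    qed
    also have "\<dots> = of_nat (card ?V) * of_real (cayley_eigenvalue n j) * (echar n (j * x) * c)"
      unfolding sum_distrib_left[symmetric] sum_echar_quad_connection_set[OF assms] by (simp add: mult_ac)
    finally show "(\<Sum>z\<in>nbrs x. echar n (j * z) * c) =
      of_nat (card ?V) * of_real (cayley_eigenvalue n j) * (echar n (j * x) * c)" .
  qed
  show ?thesis
  proof safe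
    assume "exhibits_pst ?G"
    then obtain u v \<tau> where uv: "u \<in> pverts ?G" "v \<in> pverts ?G" "u \<noteq> v" and \<tau>: "\<tau> > 0" "pst_at ?G u v \<tau>"
      unfolding exhibits_pst_def by blast
    obtain \<gamma> where \<gamma>: "\<And>f \<theta>. eigenfunction f (cos \<theta>) \<Longrightarrow> of_real (cos (real \<tau> * \<theta>)) * f u = \<gamma> * f v"
      using pst_at_imp_eigenfunctions[OF \<tau>(2) uv(1,2)] by blast
    have c: "of_real (cos (real \<tau> * ?\<theta> j)) * echar n (int j * u) = \<gamma> * echar n (int j * v)" for j
      using \<gamma>[of "\<lambda>x. echar n (int j * x)" "?\<theta> j"] eig[of "int j" 1]
      by (simp add: cos_arccos_cayley_eigenvalue)
    \<comment> \<open>The trivial character fixes the phase: its angle is 0.\<close>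
    have "cayley_eigenvalue n 0 = 1"
      using card_quad_connection_set_pos[OF assms] by (simp add: cayley_eigenvalue_def)
    then have [simp]: "\<gamma> = 1"
      using c[of 0] by simp
    have d: "of_real (cos (real \<tau> * ?\<theta> j)) = echar n (int j * (v - u))" for j
    proof -
      have "echar n (int j * u) * echar n (int j * - u) = 1"
        by (simp flip: echar_add)
      then have "of_real (cos (real \<tau> * ?\<theta> j)) = echar n (int j * v) * echar n (int j * - u)"
        using c[of j] by (metis \<open>\<gamma> = 1\<close> mult.assoc mult.right_neutral mult_1)
      then show ?thesis
        by (simp add: algebra_simps flip: echar_add)
    qed
    \<comment> \<open>For index 1 the character value is real, hence invariant under conjugation, so
      its square is 1. This makes \<open>v - u\<close> half of \<open>n\<close> up to sign.\<close>
    have "echar n (v - u) = of_real (cos (real \<tau> * ?\<theta> 1))"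
      using d[of 1] by simp
    then have "echar n (- (v - u)) = echar n (v - u)"
      unfolding echar_minus by (simp only: complex_cnj_complex_of_real)
    then have "echar n ((v - u) + (v - u)) = echar n ((v - u) + - (v - u))"
      unfolding echar_add by (simp only:)
    then have "echar n (2 * (v - u)) = 1"
      by (simp only: mult_2 add.right_inverse echar_0)
    then have "int n dvd 2 * (v - u)"
      using assms by (simp add: echar_eq_1_iff)
    then obtain k where k: "2 * (v - u) = int n * k"
      by (elim dvdE)
    have "\<bar>int n * k\<bar> < int n * 2" "k \<noteq> 0"
      using uv k by (auto simp: pverts_quad_unitary_cayley)
    then have "\<bar>k\<bar> = 1"
      using assms by (simp add: abs_mult)
    then have "k = 1 \<or> k = -1"
      by linarith
    then have vu: "2 * (v - u) = int n \<or> 2 * (v - u) = - int n"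
      unfolding k by auto
    then show "even n"
      by presburger
    show "\<exists>\<tau>>0. \<forall>j. cos (real \<tau> * ?\<theta> j) = (-1) ^ j"
    proof (intro exI conjI allI)
      fix j
      have "2 * pi * real_of_int (v - u) / real n = pi \<or> 2 * pi * real_of_int (v - u) / real n = - pi"
      proof -
        have "2 * real_of_int (v - u) = n \<or> 2 * real_of_int (v - u) = - real n"
          using vu by linarith
        moreover have "2 * pi * real_of_int (v - u) / real n = pi * (2 * real_of_int (v - u) / real n)"
          by simp
        ultimately show ?thesis
          using assms by (elim disjE) (simp_all only:, simp_all)
      qed
      then have "echar n (v - u) = -1"
        unfolding echar_def by (auto simp: complex_eq_iff)
      then have "complex_of_real (cos (real \<tau> * ?\<theta> j)) = (-1) ^ j"
        using echar_power[of n "v - u" j] d[of j] by simp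
      then show "cos (real \<tau> * ?\<theta> j) = (-1) ^ j"
        by (metis of_real_1 of_real_eq_iff of_real_minus of_real_power)
    qed (rule \<tau>(1))
  next
    fix \<tau> :: nat
    assume n: "even n" and \<tau>: "\<tau> > 0" "\<forall>j. cos (real \<tau> * ?\<theta> j) = (-1) ^ j"
    define m where "m = int n div 2"
    have m: "int n = 2 * m" "0 < m" "m < int n"
      using n assms by (auto simp: m_def)
    have half: "echar n m = -1"
    proof -
      have "real n = 2 * real_of_int m"
        using m(1) by (metis of_int_mult of_int_numeral of_int_of_nat_eq)
      then have "2 * pi * real_of_int m / real n = pi"
        using m(2) by simp
      then show ?thesis
        by (simp add: echar_def)
    qed
    \<comment> \<open>The point mass at 0 is the average of all characters.\<close>
    have delta: "(\<Sum>j<n. echar n (int j * y) * (1 / of_nat n)) = (if int n dvd y then 1 else 0)" for y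
      using assms by (simp add: sum_echar flip: sum_divide_distrib)
    have "pst_at ?G 0 m \<tau>"
    proof (rule pst_atI_eigenfunctions)
      show "finite {..<n}"
        by simp
      show "eigenfunction (\<lambda>x. echar n (int j * x) * (1 / of_nat n)) (cos (?\<theta> j))" for j
        unfolding cos_arccos_cayley_eigenvalue by (rule eig)
      show "0 \<in> pverts ?G" "m \<in> pverts ?G"
        using m assms by (auto simp: pverts_quad_unitary_cayley)
      fix x assume x: "x \<in> pverts ?G"
      then show "(\<Sum>j<n. echar n (int j * x) * (1 / of_nat n)) = (if x = 0 then 1 else 0)"
        unfolding delta pverts_quad_unitary_cayley by (auto dest: zdvd_imp_le)
      \<comment> \<open>The sign \<open>(-1) ^ j\<close> is the value of the j-th character at
        \<open>m\<close>, so the signs move the point mass from 0 to \<open>-m\<close>, which is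
        \<open>m\<close> modulo \<open>n\<close>.\<close>
      have "(\<Sum>j<n. of_real (cos (real \<tau> * ?\<theta> j)) * (echar n (int j * x) * (1 / of_nat n))) =
        (\<Sum>j<n. echar n (int j * (x + m)) * (1 / of_nat n))"
      proof (intro sum.cong refl)
        fix j
        have "complex_of_real (cos (real \<tau> * ?\<theta> j)) = echar n (int j * m)"
          using \<tau>(2) half echar_power[of n m j] by simp
        then show "of_real (cos (real \<tau> * ?\<theta> j)) * (echar n (int j * x) * (1 / of_nat n)) =
          echar n (int j * (x + m)) * (1 / of_nat n)"
          by (simp add: distrib_left echar_add)
      qed
      also have "\<dots> = (if x = m then 1 else 0)"
      proof -
        have "int n dvd x + m \<longleftrightarrow> x = m"
        proof
          assume "int n dvd x + m"
          then obtain k where k: "x + m = int n * k"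
            by (elim dvdE)
          have "0 \<le> x" "x < int n"
            using x by (simp_all add: pverts_quad_unitary_cayley)
          then have "0 < int n * k" "int n * k < int n * 2"
            using m k by linarith+
          then have "k = 1"
            using assms by (simp add: zero_less_mult_iff)
          then show "x = m"
            using k m by simp
        qed (use m in auto)
        then show ?thesis
          by (simp only: delta)
      qed
      finally show "(\<Sum>j<n. of_real (cos (real \<tau> * ?\<theta> j)) * (echar n (int j * x) * (1 / of_nat n))) =
        (if x = m then 1 else 0)" .
    qed (use \<tau> in auto)
    then show "exhibits_pst ?G"
      unfolding exhibits_pst_def using m assms \<tau>(1)
      by (intro bexI[of _ 0] bexI[of _ m]) (auto simp: pverts_quad_unitary_cayley)
  qed
qed

section \<open>Connection sets\<close>

text \<open>Take \<open>b = a + k * m\<close>, where \<open>k\<close> is the product of the primes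
  of \<open>n\<close> dividing neither \<open>a\<close> nor \<open>m\<close>. Each prime of
  \<open>n\<close> then divides exactly one of \<open>a\<close> and \<open>k * m\<close>, hence not
  their sum.\<close>

lemma exists_coprime_lift:
  fixes a m n :: int
  assumes "n \<noteq> 0" "coprime a m"
  obtains b where "[b = a] (mod m)" "coprime b n"
proof -
  define k where "k = \<Prod>{q \<in> prime_factors n. \<not> q dvd a \<and> \<not> q dvd m}"
  have dvd_k: "q dvd k \<longleftrightarrow> \<not> q dvd a \<and> \<not> q dvd m" if q: "prime q" "q dvd n" for q
  proof
    assume "q dvd k"
    then obtain r where r: "r \<in> prime_factors n" "\<not> r dvd a \<and> \<not> r dvd m" "q dvd r"
      unfolding k_def using q(1) by (subst (asm) prime_dvd_prod_iff) auto
    then have "q = r"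
      using q(1) by (simp add: in_prime_factors_iff primes_dvd_imp_eq)
    then show "\<not> q dvd a \<and> \<not> q dvd m"
      using r(2) by simp
  next
    assume "\<not> q dvd a \<and> \<not> q dvd m"
    then have "q \<in> {q \<in> prime_factors n. \<not> q dvd a \<and> \<not> q dvd m}"
      using q assms(1) by (simp add: in_prime_factors_iff)
    then show "q dvd k"
      unfolding k_def by (intro dvd_prod_eqI[of _ _ _ "\<lambda>q. q"]) auto
  qed
  have "coprime (a + k * m) n"
  proof (rule ccontr)
    assume "\<not> coprime (a + k * m) n"
    then have "\<not> is_unit (gcd (a + k * m) n)"
      by (metis is_unit_gcd)
    moreover have "gcd (a + k * m) n \<noteq> 0"
      using assms(1) by simp
    ultimately obtain q where q: "prime q" "q dvd gcd (a + k * m) n"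
      using prime_divisor_exists by blast
    then have qn: "q dvd n" and qb: "q dvd a + k * m"
      by auto
    have "q dvd k * m \<longleftrightarrow> \<not> q dvd a"
    proof (cases "q dvd m")
      case True
      then have "\<not> q dvd a"
        using assms(2) q(1) by (metis coprime_common_divisor not_prime_unit)
      with True qb show ?thesis
        by simp
    next
      case False
      then show ?thesis
        using dvd_k[OF q(1) qn] q(1) by (simp add: prime_dvd_mult_iff)
    qed
    with qb show False
      by (metis dvd_add_left_iff dvd_add_right_iff)
  qed
  moreover have "[a + k * m = a] (mod m)"
    by (simp add: cong_def)
  ultimately show ?thesis
    using that by blast
qed

lemma coprime_mem_quad_connection_set:
  assumes "n \<ge> 2" "s \<in> quad_connection_set n"
  shows "coprime s (int n)"
proof -
  obtain r where r: "coprime r (int n)" "[s = r\<^sup>2] (mod int n) \<or> [s = - r\<^sup>2] (mod int n)"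
    using assms by (auto simp: mem_quad_connection_set)
  have "coprime (r\<^sup>2) (int n)" "coprime (- r\<^sup>2) (int n)"
    using r(1) by simp_all
  with r(2) show ?thesis
    by (elim disjE) (erule cong_imp_coprime[OF cong_sym], assumption)+
qed

lemma mult_mem_quad_connection_set:
  assumes "n \<ge> 2" "s \<in> quad_connection_set n" "t \<in> quad_connection_set n"
  shows "(s * t) mod int n \<in> quad_connection_set n"
proof -
  obtain r where r: "coprime r (int n)" "[s = r\<^sup>2] (mod int n) \<or> [s = - r\<^sup>2] (mod int n)"
    using assms by (auto simp: mem_quad_connection_set)
  obtain q where q: "coprime q (int n)" "[t = q\<^sup>2] (mod int n) \<or> [t = - q\<^sup>2] (mod int n)"
    using assms by (auto simp: mem_quad_connection_set)
  have "[s * t = (r * q)\<^sup>2] (mod int n) \<or> [s * t = - (r * q)\<^sup>2] (mod int n)"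
    using r(2) q(2) cong_mult[of s _ "int n" t] unfolding power_mult_distrib
    by (metis minus_mult_left minus_mult_right minus_minus)
  moreover have "coprime (r * q) (int n)"
    using r(1) q(1) by simp
  ultimately show ?thesis
    using mod_mem_quad_connection_set[OF assms(1)] by blast
qed

lemma mod_mem_quad_connection_set_dvd:
  assumes "n \<ge> 2" "m \<ge> 2" "m dvd n" "s \<in> quad_connection_set n"
  shows "s mod int m \<in> quad_connection_set m"
proof -
  obtain r where r: "coprime r (int n)" "[s = r\<^sup>2] (mod int n) \<or> [s = - r\<^sup>2] (mod int n)"
    using assms by (auto simp: mem_quad_connection_set)
  have "int m dvd int n"
    using assms(3) by simp
  then have "[s = r\<^sup>2] (mod int m) \<or> [s = - r\<^sup>2] (mod int m)"
    using r(2) cong_dvd_modulus by blast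
  moreover have "coprime r (int m)"
    using coprime_divisors[OF dvd_refl \<open>int m dvd int n\<close> r(1)] .
  ultimately show ?thesis
    using mod_mem_quad_connection_set[OF assms(2)] by blast
qed

text \<open>Reduction modulo \<open>m\<close> is onto: the root of \<open>w\<close> lifts to a unit
  modulo \<open>n\<close>, and its square lifts with it.\<close>

lemma lift_quad_connection_set:
  assumes "n \<ge> 2" "m \<ge> 2" "m dvd n" "w \<in> quad_connection_set m"
  obtains s where "s \<in> quad_connection_set n" "s mod int m = w"
proof -
  obtain r where r: "coprime r (int m)" "[w = r\<^sup>2] (mod int m) \<or> [w = - r\<^sup>2] (mod int m)"
    and w: "0 \<le> w" "w < int m"
    using assms by (auto simp: mem_quad_connection_set)
  obtain b where b: "[b = r] (mod int m)" "coprime b (int n)"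
    using exists_coprime_lift[of "int n" r "int m"] r(1) assms(1) by auto
  have "[w = b\<^sup>2] (mod int m) \<or> [w = - b\<^sup>2] (mod int m)"
    using r(2) cong_pow[OF b(1), of 2] by (metis cong_minus_minus_iff cong_sym cong_trans)
  moreover have "x mod int n mod int m = x mod int m" for x
    using assms(3) by (simp add: mod_mod_cancel)
  ultimately have "(b\<^sup>2 mod int n) mod int m = w \<or> ((- b\<^sup>2) mod int n) mod int m = w"
    using w by (auto simp: cong_def)
  moreover have "b\<^sup>2 mod int n \<in> quad_connection_set n" "(- b\<^sup>2) mod int n \<in> quad_connection_set n"
    using mod_mem_quad_connection_set[OF assms(1) b(2)] by auto
  ultimately show ?thesis
    using that by blast
qed

text \<open>The connection set is finite, closed under products and made of units, so multiplication
  by \<open>t\<close> permutes it.\<close>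

lemma sum_mult_quad_connection_set:
  assumes "n \<ge> 2" "t \<in> quad_connection_set n"
  shows "(\<Sum>s\<in>quad_connection_set n. F ((t * s) mod int n)) = (\<Sum>s\<in>quad_connection_set n. F s)"
proof -
  let ?V = "quad_connection_set n"
  have inj: "inj_on (\<lambda>s. (t * s) mod int n) ?V"
  proof (rule inj_onI)
    fix x y assume xy: "x \<in> ?V" "y \<in> ?V" "(t * x) mod int n = (t * y) mod int n"
    then have "[x = y] (mod int n)"
      using cong_mult_lcancel[of t "int n" x y] coprime_mem_quad_connection_set[OF assms]
      by (simp add: cong_def)
    then show "x = y"
      using subsetD[OF quad_connection_set_subset[OF assms(1)] xy(1)]
        subsetD[OF quad_connection_set_subset[OF assms(1)] xy(2)] by (simp add: cong_def)
  qed
  moreover have "(\<lambda>s. (t * s) mod int n) ` ?V = ?V"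
    using assms mult_mem_quad_connection_set inj by (intro endo_inj_surj) auto
  ultimately show ?thesis
    using sum.reindex[of "\<lambda>s. (t * s) mod int n" ?V F] by simp
qed

text \<open>Both sides equal the sum of \<open>F (s * w mod m)\<close> over all pairs of \<open>s\<close> and \<open>w\<close>.\<close>

lemma sum_quad_connection_set_mod:
  fixes F :: "int \<Rightarrow> real"
  assumes "n \<ge> 2" "m \<ge> 2" "m dvd n"
  shows "card (quad_connection_set m) * (\<Sum>s\<in>quad_connection_set n. F (s mod int m)) =
    card (quad_connection_set n) * (\<Sum>w\<in>quad_connection_set m. F w)"
proof -
  let ?V = "quad_connection_set n" and ?W = "quad_connection_set m"
  have "(\<Sum>w\<in>?W. \<Sum>s\<in>?V. F ((s * w) mod int m)) = (\<Sum>w\<in>?W. \<Sum>s\<in>?V. F (s mod int m))"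
  proof (rule sum.cong[OF refl])
    fix w assume "w \<in> ?W"
    then obtain t where t: "t \<in> ?V" "t mod int m = w"
      using lift_quad_connection_set[OF assms] by blast
    have "(\<Sum>s\<in>?V. F ((s * w) mod int m)) = (\<Sum>s\<in>?V. F (((t * s) mod int n) mod int m))"
      using assms(3) by (simp add: mod_mod_cancel mod_simps mult.commute flip: t(2))
    also have "\<dots> = (\<Sum>s\<in>?V. F (s mod int m))"
      by (rule sum_mult_quad_connection_set[OF assms(1) t(1)])
    finally show "(\<Sum>s\<in>?V. F ((s * w) mod int m)) = (\<Sum>s\<in>?V. F (s mod int m))" .
  qed
  moreover have "(\<Sum>s\<in>?V. \<Sum>w\<in>?W. F ((s * w) mod int m)) = (\<Sum>s\<in>?V. \<Sum>w\<in>?W. F w)"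
  proof (rule sum.cong[OF refl])
    fix s assume "s \<in> ?V"
    then have "s mod int m \<in> ?W"
      by (rule mod_mem_quad_connection_set_dvd[OF assms])
    from sum_mult_quad_connection_set[OF assms(2) this, of F]
    show "(\<Sum>w\<in>?W. F ((s * w) mod int m)) = (\<Sum>w\<in>?W. F w)"
      by (simp add: mod_simps)
  qed
  ultimately show ?thesis
    using sum.swap[of "\<lambda>s w. F ((s * w) mod int m)" ?W ?V] by simp
qed

section \<open>Eigenvalue identities and integrality of doubled eigenvalues\<close>

lemma cayley_eigenvalue_echar:
  "cayley_eigenvalue n j =
    (\<Sum>s\<in>quad_connection_set n. Re (echar n (j * s))) / card (quad_connection_set n)"
  by (simp add: cayley_eigenvalue_def echar_def)

text \<open>A character whose index is a multiple of \<open>n / m\<close> factors through the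
  residues modulo \<open>m\<close>, and reduction turns the average over one connection set into the
  average over the other.\<close>

lemma cayley_eigenvalue_dvd:
  assumes "n \<ge> 2" "m \<ge> 2" "m dvd n"
  shows "cayley_eigenvalue n (j * int (n div m)) = cayley_eigenvalue m j"
proof -
  obtain k where k: "n = m * k"
    using assms(3) by (elim dvdE)
  then have "k > 0"
    using assms(1) by (cases k) auto
  have e: "echar n (j * int k * s) = echar m (j * (s mod int m))" for s
  proof -
    have "2 * pi * of_int (j * int k * s) / real n = 2 * pi * of_int (j * s) / real m"
      using \<open>k > 0\<close> assms(2) by (simp add: k field_simps)
    then have "echar n (j * int k * s) = echar m (j * s)"
      by (simp only: echar_def)
    also have "\<dots> = echar m (j * (s mod int m))"
      using assms(2) by (intro echar_cong) (auto simp: cong_def mod_simps)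
    finally show ?thesis .
  qed
  have "n div m = k"
    using k assms(2) by simp
  moreover have "card (quad_connection_set m) * (\<Sum>s\<in>quad_connection_set n. Re (echar n (j * int k * s))) =
    card (quad_connection_set n) * (\<Sum>w\<in>quad_connection_set m. Re (echar m (j * w)))"
    unfolding e by (rule sum_quad_connection_set_mod[OF assms])
  ultimately show ?thesis
    unfolding cayley_eigenvalue_echar
    using card_quad_connection_set_pos[OF assms(1)] card_quad_connection_set_pos[OF assms(2)]
    by (simp add: field_simps)
qed

text \<open>Translation by \<open>t\<close> preserves the character sum but multiplies it by
  \<open>echar n (j * t)\<close>, which differs from 1.\<close>

lemma cayley_eigenvalue_eq_0:
  assumes "n \<ge> 2" "\<And>s. s \<in> quad_connection_set n \<Longrightarrow> (s + t) mod int n \<in> quad_connection_set n"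
    "\<not> int n dvd j * t"
  shows "cayley_eigenvalue n j = 0"
proof -
  let ?V = "quad_connection_set n"
  have inj: "inj_on (\<lambda>s. (t + s) mod int n) ?V"
    by (rule inj_on_translate(1)[OF assms(1)])
  then have img: "(\<lambda>s. (t + s) mod int n) ` ?V = ?V"
    using assms by (intro endo_inj_surj) (auto simp: add.commute)
  have "(\<Sum>s\<in>?V. echar n (j * s)) = (\<Sum>s\<in>?V. echar n (j * ((t + s) mod int n)))"
    using sum.reindex[OF inj, of "\<lambda>s. echar n (j * s)"] by (simp add: img)
  also have "\<dots> = (\<Sum>s\<in>?V. echar n (j * t) * echar n (j * s))"
    unfolding echar_add[symmetric] distrib_left[symmetric]
    using assms(1) by (intro sum.cong refl echar_cong) (auto simp: cong_def mod_simps)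
  also have "\<dots> = echar n (j * t) * (\<Sum>s\<in>?V. echar n (j * s))"
    by (rule sum_distrib_left[symmetric])
  finally have "(\<Sum>s\<in>?V. echar n (j * s)) = echar n (j * t) * (\<Sum>s\<in>?V. echar n (j * s))" .
  moreover have "echar n (j * t) \<noteq> 1"
    using assms(1,3) by (simp add: echar_eq_1_iff)
  ultimately have "(\<Sum>s\<in>?V. echar n (j * s)) = 0"
    by simp
  then show ?thesis
    using sum_echar_quad_connection_set[OF assms(1), of j] card_quad_connection_set_pos[OF assms(1)]
    by simp
qed

text \<open>The trace of the squared normalised adjacency matrix: by orthogonality of characters
  only the pairs with \<open>t = - s\<close> modulo \<open>n\<close> contribute.\<close>

lemma sum_cayley_eigenvalue_square:
  assumes "n \<ge> 2"
  shows "(\<Sum>j<n. (cayley_eigenvalue n (int j))\<^sup>2) = real n / card (quad_connection_set n)"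
proof -
  let ?V = "quad_connection_set n"
  let ?d = "card ?V"
  have "complex_of_real (real ?d ^ 2 * (\<Sum>j<n. (cayley_eigenvalue n (int j))\<^sup>2)) =
    (\<Sum>j<n. (\<Sum>s\<in>?V. echar n (int j * s)) * (\<Sum>t\<in>?V. echar n (int j * t)))"
    by (simp only: sum_echar_quad_connection_set[OF assms])
      (simp add: sum_distrib_left power2_eq_square mult_ac)
  also have "\<dots> = (\<Sum>j<n. \<Sum>s\<in>?V. \<Sum>t\<in>?V. echar n (int j * (s + t)))"
    by (simp add: sum_product distrib_left echar_add)
  also have "\<dots> = (\<Sum>s\<in>?V. \<Sum>j<n. \<Sum>t\<in>?V. echar n (int j * (s + t)))"
    by (rule sum.swap)
  also have "\<dots> = (\<Sum>s\<in>?V. \<Sum>t\<in>?V. \<Sum>j<n. echar n (int j * (s + t)))"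
    by (intro sum.cong refl sum.swap)
  also have "\<dots> = (\<Sum>s\<in>?V. of_nat n)"
  proof (intro sum.cong refl)
    fix s assume s: "s \<in> ?V"
    have "int n dvd s + t \<longleftrightarrow> t = (- s) mod int n" if t: "t \<in> ?V" for t
    proof -
      have "int n dvd s + t \<longleftrightarrow> [t = - s] (mod int n)"
        by (simp add: cong_iff_dvd_diff add.commute)
      moreover have "t mod int n = t"
        using t quad_connection_set_subset[OF assms] by auto
      ultimately show ?thesis
        by (simp add: cong_def)
    qed
    then have "(\<Sum>t\<in>?V. \<Sum>j<n. echar n (int j * (s + t))) =
      (\<Sum>t\<in>?V. if t = (- s) mod int n then of_nat n else 0)"
      using assms by (intro sum.cong refl) (simp add: sum_echar)
    also have "\<dots> = of_nat n"
      using uminus_mem_quad_connection_set[OF assms s] assms by simp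
    finally show "(\<Sum>t\<in>?V. \<Sum>j<n. echar n (int j * (s + t))) = of_nat n" .
  qed
  also have "\<dots> = complex_of_real (real ?d * real n)"
    by simp
  finally have "real ?d ^ 2 * (\<Sum>j<n. (cayley_eigenvalue n (int j))\<^sup>2) = real ?d * real n"
    by (simp only: of_real_eq_iff)
  then show ?thesis
    using card_quad_connection_set_pos[OF assms] by (simp add: field_simps power2_eq_square)
qed

text \<open>The hypothesis makes \<open>\<tau> * \<theta>\<close> a multiple of \<open>pi\<close>,
  so \<open>2 * cos \<theta>\<close> is the sum of a root of unity of order dividing
  \<open>2 * \<tau>\<close> and its inverse. Multiplication by such a root permutes all of these
  roots.\<close>

lemma two_cos_mem_stabilizer_ring:
  assumes "\<bar>cos (real \<tau> * \<theta>)\<bar> = 1" "\<tau> > 0"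
  shows "of_real (2 * cos \<theta>) \<in> stabilizer_ring (2 * \<tau>) (\<lambda>k. echar (2 * \<tau>) (int k))"
proof -
  define N where "N = 2 * \<tau>"
  have N: "N > 0" "real N = 2 * real \<tau>"
    using assms(2) by (simp_all add: N_def)
  have "sin (real \<tau> * \<theta>) = 0"
    using assms(1) sin_squared_eq[of "real \<tau> * \<theta>"] power2_abs[of "cos (real \<tau> * \<theta>)"] by simp
  then obtain i where i: "real \<tau> * \<theta> = of_int i * pi"
    by (auto simp: sin_zero_iff_int2)
  have mem: "echar N a \<in> stabilizer_ring N (\<lambda>k. echar N (int k))" for a
  proof (rule stabilizer_ringI)
    fix k
    let ?l = "nat ((a + int k) mod int N)"
    have l: "int ?l = (a + int k) mod int N" "?l < N"
      using N by (simp_all add: nat_less_iff)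
    have "(\<Sum>l<N. of_int (if l = ?l then 1 else 0) * echar N (int l)) = echar N (int ?l)"
      using l(2) by (simp add: if_distrib[of of_int] if_distrib[of "\<lambda>x. x * _"] cong: if_cong)
    also have "\<dots> = echar N (a + int k)"
      using N(1) unfolding l(1) by (intro echar_cong) (auto simp: cong_def)
    finally show "echar N a * echar N (int k) =
        (\<Sum>l<N. of_int (if l = ?l then 1 else 0) * echar N (int l))"
      by (simp add: echar_add)
  qed
  have "\<theta> = 2 * pi * of_int i / real N"
    using i N assms(2) by (simp add: field_simps)
  then have "of_real (2 * cos \<theta>) = echar N i + echar N (- i)"
    unfolding echar_minus by (simp add: echar_def complex_eq_iff)
  then show ?thesis
    using stabilizer_ring_add[OF mem mem, of i "- i"] unfolding N_def by simp
qed

section \<open>Classification\<close>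

text \<open>\<open>cos (k * x)\<close> is a polynomial in \<open>cos x\<close>, so the branch chosen
  by \<open>arccos\<close> does not matter.\<close>

lemma cos_of_nat_mult_arccos_cos: "cos (real k * arccos (cos x)) = cos (real k * x)"
proof (cases k)
  case (Suc l)
  have "cos (arccos (cos x)) = cos x"
    by simp
  then show ?thesis
    unfolding Suc cheb_cos[symmetric] by simp
qed simp

text \<open>An executable form, from which concrete connection sets are computed.\<close>

lemma quad_connection_set_eval:
  assumes "n \<ge> 2"
  shows "quad_connection_set n = set (concat (map (\<lambda>r. [r\<^sup>2 mod int n, (- r\<^sup>2) mod int n])
    (filter (\<lambda>r. gcd r (int n) = 1) [0..int n - 1])))" (is "_ = ?R")
proof
  show "?R \<subseteq> quad_connection_set n"
    using assms by (auto simp: coprime_iff_gcd_eq_1 intro!: mod_mem_quad_connection_set)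
  show "quad_connection_set n \<subseteq> ?R"
  proof
    fix s assume "s \<in> quad_connection_set n"
    then obtain r where r: "coprime r (int n)" "[s = r\<^sup>2] (mod int n) \<or> [s = - r\<^sup>2] (mod int n)"
      and s: "0 \<le> s" "s < int n"
      using assms by (auto simp: mem_quad_connection_set)
    let ?q = "r mod int n"
    have q: "?q \<in> set (filter (\<lambda>r. gcd r (int n) = 1) [0..int n - 1])"
      using r(1) assms by (simp add: coprime_iff_gcd_eq_1[symmetric])
    have e: "?q\<^sup>2 mod int n = r\<^sup>2 mod int n" "(- ?q\<^sup>2) mod int n = (- r\<^sup>2) mod int n"
      by (metis power_mod) (metis power_mod mod_minus_eq)
    have "s = ?q\<^sup>2 mod int n \<or> s = (- ?q\<^sup>2) mod int n"
      using r(2) s unfolding e by (auto simp: cong_def)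
    then have "s \<in> set ((\<lambda>r. [r\<^sup>2 mod int n, (- r\<^sup>2) mod int n]) ?q)"
      by auto
    with q show "s \<in> ?R"
      unfolding set_concat set_map by blast
  qed
qed

section \<open>Concrete connection sets and the graphs with transfer\<close>

lemma quad_connection_set_concrete:
  "quad_connection_set 2 = {1}"
  "quad_connection_set 4 = {1, 3}"
  "quad_connection_set 6 = {1, 5}"
  "quad_connection_set 7 = {1, 2, 3, 4, 5, 6}"
  "quad_connection_set 8 = {1, 7}"
  "quad_connection_set 10 = {1, 9}"
  "quad_connection_set 12 = {1, 11}"
  "quad_connection_set 15 = {1, 4, 11, 14}"
  "quad_connection_set 20 = {1, 9, 11, 19}"
  "quad_connection_set 24 = {1, 23}"
  "quad_connection_set 40 = {1, 9, 31, 39}"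
  by (subst quad_connection_set_eval, simp, code_simp)+

text \<open>Identifies the cosines for \<open>s\<close> and \<open>- s\<close> modulo
  \<open>n\<close>, so half of a concrete connection set determines the eigenvalue.\<close>

lemma cos_complement_mod:
  assumes "n > 0" "int n dvd s + t"
  shows "cos (2 * pi * of_int (j * s) / of_nat n) = cos (2 * pi * of_int (j * t) / of_nat n)"
proof -
  have "echar n (j * s) = echar n (- (j * t))"
    using assms by (intro echar_cong) (auto simp: cong_iff_dvd_diff simp flip: distrib_left)
  then have "Re (echar n (j * s)) = Re (echar n (j * t))"
    unfolding echar_minus by simp
  then show ?thesis
    by (simp add: echar_def)
qed

text \<open>The eigenvalues are \<open>cos (2 * pi * j / n)\<close>, and at time
  \<open>n / 2\<close> the angle becomes \<open>j * pi\<close>.\<close>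

lemma exhibits_pst_cycle:
  assumes "n \<ge> 2" "even n" "quad_connection_set n = {1, int n - 1}"
  shows "exhibits_pst (quad_unitary_cayley n)"
proof -
  have eig: "cayley_eigenvalue n j = cos (2 * pi * of_int j / of_nat n)" for j
  proof -
    have "cos (2 * pi * of_int (j * s) / of_nat n) = cos (2 * pi * of_int j / of_nat n)"
      if "s \<in> quad_connection_set n" for s
      using that assms cos_complement_mod[of n s 1 j] by auto
    then show ?thesis
      unfolding cayley_eigenvalue_def using card_quad_connection_set_pos[OF assms(1)] by simp
  qed
  have "cos (real (n div 2) * arccos (cayley_eigenvalue n (int j))) = (-1) ^ j" for j
  proof -
    have "real (n div 2) * (2 * pi * of_int (int j) / of_nat n) = real j * pi"
      using assms(1,2) by (auto elim!: evenE)
    then show ?thesis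
      unfolding eig cos_of_nat_mult_arccos_cos by (simp only: cos_npi)
  qed
  moreover have "n div 2 > 0"
    using assms(1) by simp
  ultimately show ?thesis
    unfolding exhibits_pst_quad_unitary_cayley_iff[OF assms(1)] using assms(2) by blast
qed

text \<open>Up to sign the connection set is 1 and 9, and the sum of their cosines becomes a
  product. Time 10 works: for odd indices the eigenvalue is 0, the angle is \<open>pi / 2\<close>,
  and ten times it is \<open>5 * pi\<close>.\<close>

lemma exhibits_pst_20: "exhibits_pst (quad_unitary_cayley 20)"
proof -
  have eig: "cayley_eigenvalue 20 j = cos (pi * of_int j / 2) * cos (2 * pi * of_int j / 5)" for j
  proof -
    have "cayley_eigenvalue 20 j = (cos (2 * pi * of_int j / 20) + cos (2 * pi * (9 * of_int j) / 20)) / 2"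
      using cos_complement_mod[of 20 11 9 j] cos_complement_mod[of 20 19 1 j]
      unfolding cayley_eigenvalue_def quad_connection_set_concrete by (simp add: mult_ac)
    also have "\<dots> = cos (pi * of_int j / 2) * cos (- (2 * pi * of_int j / 5))"
      unfolding cos_plus_cos by (simp add: field_simps)
    finally show ?thesis
      by simp
  qed
  have "cos (real 10 * arccos (cayley_eigenvalue 20 (int j))) = (-1) ^ j" for j
  proof (cases "even j")
    case True
    then obtain i where i: "j = 2 * i"
      by (elim evenE)
    \<comment> \<open>As \<open>sin (i * pi)\<close> vanishes, the product of cosines is the cosine
      of the sum; ten times that angle is an even multiple of \<open>pi\<close>.\<close>
    have "cayley_eigenvalue 20 (int j) = cos (real i * pi + 4 * pi * real i / 5)"
      unfolding eig cos_add by (simp add: i mult_ac)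
    then have "cos (real 10 * arccos (cayley_eigenvalue 20 (int j))) =
      cos (real 10 * (real i * pi + 4 * pi * real i / 5))"
      by (simp only: cos_of_nat_mult_arccos_cos)
    also have "real 10 * (real i * pi + 4 * pi * real i / 5) = real (18 * i) * pi"
      by (simp add: field_simps)
    also have "cos \<dots> = (-1) ^ j"
      unfolding cos_npi by (simp add: i power_mult)
    finally show ?thesis .
  next
    case False
    then obtain i where i: "j = 2 * i + 1"
      by (elim oddE)
    have "pi * of_int (int j) / 2 = real i * pi + pi / 2"
      by (simp add: i field_simps)
    then have "cos (pi * of_int (int j) / 2) = 0"
      by (simp only: cos_add) simp
    then have "cayley_eigenvalue 20 (int j) = cos (pi / 2)"
      unfolding eig by simp
    then have "cos (real 10 * arccos (cayley_eigenvalue 20 (int j))) = cos (real 10 * (pi / 2))"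
      by (simp only: cos_of_nat_mult_arccos_cos)
    also have "real 10 * (pi / 2) = real 5 * pi"
      by simp
    also have "cos \<dots> = (-1) ^ j"
      unfolding cos_npi by (simp add: i)
    finally show ?thesis .
  qed
  then show ?thesis
    by (subst exhibits_pst_quad_unitary_cayley_iff) (auto intro!: exI[of _ 10])
qed

text \<open>The square of \<open>1 + t * u\<close> is \<open>1 + 2 * t * u\<close> modulo
  \<open>n\<close>, and this number is a unit since it is coprime to \<open>t\<close>. Multiplying
  \<open>s\<close> by its square therefore adds \<open>c\<close> and stays in the set.\<close>

lemma translate_mem_quad_connection_set:
  assumes "n \<ge> 2" "s \<in> quad_connection_set n" "int n dvd t\<^sup>2" "[2 * s * t * u = c] (mod int n)"
  shows "(s + c) mod int n \<in> quad_connection_set n"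
proof -
  obtain r where r: "coprime r (int n)" "[s = r\<^sup>2] (mod int n) \<or> [s = - r\<^sup>2] (mod int n)"
    using assms by (auto simp: mem_quad_connection_set)
  have "coprime (1 + t * u) t"
    by (metis coprime_1_left coprime_commute gcd_add_mult coprime_iff_gcd_eq_1 add.commute mult.commute)
  then have "coprime (1 + t * u) (t\<^sup>2)"
    by simp
  then have "coprime (1 + t * u) (int n)"
    using assms(3) coprime_divisors dvd_refl by blast
  then have cop: "coprime (r * (1 + t * u)) (int n)"
    using r(1) by simp
  have "[s * (1 + t * u)\<^sup>2 = s + c] (mod int n)"
  proof -
    have diff: "s * (1 + t * u)\<^sup>2 - (s + c) = (2 * s * t * u - c) + t\<^sup>2 * (s * u\<^sup>2)"
      by (simp add: power2_eq_square algebra_simps)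
    show ?thesis
      using assms(3,4) unfolding cong_iff_dvd_diff diff by simp
  qed
  moreover have "[s * (1 + t * u)\<^sup>2 = (r * (1 + t * u))\<^sup>2] (mod int n) \<or>
      [s * (1 + t * u)\<^sup>2 = - (r * (1 + t * u))\<^sup>2] (mod int n)"
    using r(2) cong_scalar_right[of s _ "int n" "(1 + t * u)\<^sup>2"]
    unfolding power_mult_distrib mult_minus_left[symmetric] by blast
  ultimately have "[s + c = (r * (1 + t * u))\<^sup>2] (mod int n) \<or>
      [s + c = - (r * (1 + t * u))\<^sup>2] (mod int n)"
    using cong_sym cong_trans by blast
  then show ?thesis
    using mod_mem_quad_connection_set[OF assms(1) cop] by blast
qed

text \<open>Multiply by \<open>4 * sin (pi / 5)\<close> and double the angle twice;
  \<open>4 * pi / 5\<close> and \<open>pi / 5\<close> have the same sine.\<close>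

lemma cos_pi_fifth_product: "cos (pi / 5) * cos (2 * pi / 5) = 1 / 4"
proof -
  have "sin (pi / 5) * (4 * (cos (pi / 5) * cos (2 * pi / 5))) =
    2 * (2 * sin (pi / 5) * cos (pi / 5)) * cos (2 * pi / 5)"
    by simp
  also have "2 * sin (pi / 5) * cos (pi / 5) = sin (2 * pi / 5)"
    using sin_double[of "pi / 5"] by simp
  also have "2 * sin (2 * pi / 5) * cos (2 * pi / 5) = sin (4 * pi / 5)"
    using sin_double[of "2 * pi / 5"] by simp
  also have "4 * pi / 5 = pi - pi / 5"
    by simp
  also have "sin (pi - pi / 5) = sin (pi / 5)"
    by (rule sin_pi_minus)
  finally have "sin (pi / 5) * (4 * (cos (pi / 5) * cos (2 * pi / 5))) = sin (pi / 5)" .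
  moreover have "sin (pi / 5) \<noteq> 0"
    using sin_gt_zero[of "pi / 5"] by simp
  ultimately show ?thesis
    by simp
qed

section \<open>Necessary conditions on \<open>n\<close> from an alternating sign pattern\<close>

context
  fixes n \<tau> :: nat
  assumes n2: "n \<ge> 2" and \<tau>_pos: "\<tau> > 0"
    and alternating: "\<And>j. cos (real \<tau> * arccos (cayley_eigenvalue n (int j))) = (-1) ^ j"
begin

text \<open>The left side is independent of \<open>j\<close>, so all vanishing eigenvalues have
  indices of the same parity.\<close>

lemma eigenvalue_0_imp_odd:
  assumes "cayley_eigenvalue n (int j) = 0"
  shows "cos (real \<tau> * (pi / 2)) = (-1) ^ j"
  using alternating[of j] by (simp add: assms)

text \<open>
  If \<open>p\<^sup>2\<close> divides \<open>n\<close>, then \<open>(1 + n/p * u)\<^sup>2 \<equiv> 1 + 2 * n/p * u\<close> modulo \<open>n\<close>. Hence the connection set is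
  invariant under translation by \<open>n/p\<close>, and the eigenvalues with indices \<open>1\<close> and \<open>2\<close> both vanish.
\<close>

lemma odd_prime_square_not_dvd:
  assumes "prime p" "odd p"
  shows "\<not> p\<^sup>2 dvd n"
proof
  assume "p\<^sup>2 dvd n"
  then obtain k where k: "n = p\<^sup>2 * k"
    by (elim dvdE)
  have p: "p \<ge> 3" and k0: "k > 0"
    using assms n2 k prime_ge_2_nat[OF assms(1)] by (auto simp: order_le_less intro: Suc_leI gr0I)
  define t where "t = int (p * k)"
  have t: "t > 0" "int n = int p * t"
    using p k0 by (simp_all add: t_def k power2_eq_square)
  have "(s + t) mod int n \<in> quad_connection_set n" if s: "s \<in> quad_connection_set n" for s
  proof -
    \<comment> \<open>As \<open>p\<close> is odd, \<open>2 * s\<close> is invertible modulo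
      \<open>p\<close>; with \<open>u\<close> its inverse the translation is by
      \<open>t = n / p\<close>.\<close>
    have "coprime s (int p)"
      using coprime_mem_quad_connection_set[OF n2 s] t by simp
    moreover have "coprime 2 (int p)"
      using assms(2) by simp
    ultimately have "coprime (2 * s) (int p)"
      by simp
    then obtain u where "[2 * s * u = 1] (mod int p)"
      using cong_solve_coprime_int by blast
    then have "int p * t dvd (2 * s * u - 1) * t"
      by (simp add: cong_iff_dvd_diff)
    then have "[2 * s * t * u = t] (mod int n)"
      unfolding cong_iff_dvd_diff t(2) by (simp add: algebra_simps)
    moreover have "int n dvd t\<^sup>2"
      by (simp add: t_def k power2_eq_square)
    ultimately show ?thesis
      using translate_mem_quad_connection_set[OF n2 s] by blast
  qed
  \<comment> \<open>Since \<open>p >= 3\<close>, \<open>j * t\<close> lies strictly between 0 and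
    \<open>n\<close>.\<close>
  then have eig: "cayley_eigenvalue n (int j) = 0" if "j \<in> {1, 2}" for j
    using that p t by (intro cayley_eigenvalue_eq_0[OF n2, of t]) (auto dest!: zdvd_imp_le dvd_imp_le)
  show False
    using eigenvalue_0_imp_odd[OF eig[of 1]] eigenvalue_0_imp_odd[OF eig[of 2]] by simp
qed

text \<open>
  The eigenvalue with index \<open>1\<close> vanishes, which forces \<open>\<tau> \<equiv> 2\<close> modulo \<open>4\<close>, whereas the eigenvalue
  \<open>cos (\<pi>/4)\<close> with even index \<open>n/8\<close> forces \<open>8\<close> to divide \<open>\<tau>\<close>.
\<close>

lemma sixteen_not_dvd: "\<not> 16 dvd n"
proof
  assume "16 dvd n"
  then obtain k where k: "n = 16 * k"
    by (elim dvdE)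
  then have k0: "k > 0"
    using n2 by auto
  have "(s + int (8 * k)) mod int n \<in> quad_connection_set n" if s: "s \<in> quad_connection_set n" for s
  proof -
    have "coprime s 2"
      using coprime_mem_quad_connection_set[OF n2 s] coprime_divisors[of s s 2 "int n"] k by auto
    then obtain l where "s = 2 * l + 1"
      by (auto elim: oddE)
    \<comment> \<open>Translation with \<open>t = 4 * k\<close> and \<open>u = 1\<close>: as
      \<open>s\<close> is odd, \<open>8 * k * s\<close> and \<open>8 * k\<close> agree modulo
      \<open>16 * k\<close>.\<close>
    then have "2 * s * int (4 * k) * 1 - int (8 * k) = int n * l"
      by (simp add: k algebra_simps)
    then have "[2 * s * int (4 * k) * 1 = int (8 * k)] (mod int n)"
      unfolding cong_iff_dvd_diff by simp
    moreover have "int n dvd (int (4 * k))\<^sup>2"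
      by (simp add: k power2_eq_square)
    ultimately show ?thesis
      using translate_mem_quad_connection_set[OF n2 s] by blast
  qed
  then have "cayley_eigenvalue n (int 1) = 0"
    using k k0 by (intro cayley_eigenvalue_eq_0[OF n2, of "int (8 * k)"]) (auto dest!: zdvd_imp_le)
  then have "cos (real \<tau> * (pi / 2)) = -1"
    using eigenvalue_0_imp_odd by fastforce
  moreover have "cos (real \<tau> * (pi / 4)) = 1"
  proof -
    have "cayley_eigenvalue n (1 * int (n div 8)) = cayley_eigenvalue 8 1"
      using n2 k by (intro cayley_eigenvalue_dvd) auto
    moreover have "n div 8 = 2 * k"
      using k by simp
    moreover have "cayley_eigenvalue 8 1 = cos (pi / 4)"
      using cos_complement_mod[of 8 7 1 1]
      unfolding cayley_eigenvalue_def quad_connection_set_concrete by (simp add: mult.commute)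
    ultimately have "cayley_eigenvalue n (int (2 * k)) = cos (pi / 4)"
      by simp
    then show ?thesis
      using alternating[of "2 * k"] by (simp add: cos_of_nat_mult_arccos_cos)
  qed
  moreover have "cos (real \<tau> * (pi / 2)) = 2 * (cos (real \<tau> * (pi / 4)))\<^sup>2 - 1"
    using cos_double_cos[of "real \<tau> * (pi / 4)"] by (simp add: mult.commute)
  ultimately show False
    by simp
qed

text \<open>The span of the roots of unity of order dividing \<open>2 * \<tau>\<close> is a
  cyclotomic ring containing 1, so its multiplier ring is that ring itself.\<close>

abbreviation (input) periodic_ring :: "complex set" where
  "periodic_ring \<equiv> stabilizer_ring (2 * \<tau>) (\<lambda>k. echar (2 * \<tau>) (int k))"

text \<open>The eigenvalues for \<open>m\<close> occur among those for \<open>n\<close>, where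
  \<open>alternating\<close> makes the cosine at time \<open>\<tau>\<close> equal to 1 or
  -1.\<close>

lemma two_eigenvalue_mem_ring:
  assumes "m \<ge> 2" "m dvd n"
  shows "of_real (2 * cayley_eigenvalue m (int j)) \<in> periodic_ring"
proof -
  define i where "i = j * (n div m)"
  have eq: "cayley_eigenvalue m (int j) = cayley_eigenvalue n (int i)"
    using cayley_eigenvalue_dvd[OF n2 assms, of "int j"] by (simp add: i_def)
  have "\<bar>cos (real \<tau> * arccos (cayley_eigenvalue n (int i)))\<bar> = 1"
    unfolding alternating by (simp add: power_abs)
  from two_cos_mem_stabilizer_ring[OF this \<tau>_pos] show ?thesis
    unfolding cos_arccos_cayley_eigenvalue eq .
qed

lemma rational_mem_ring_imp_int:
  assumes "of_real x \<in> periodic_ring" "x \<in> \<rat>"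
  shows "x \<in> \<int>"
proof -
  \<comment> \<open>Index 0 supplies the nonzero generator
    \<open>echar (2 * \<tau>) 0 = 1\<close>.\<close>
  have "algebraic_int (complex_of_real x)"
    using algebraic_int_stabilizer_ring[OF assms(1), of 0] \<tau>_pos by simp
  then show ?thesis
    using assms(2) rational_algebraic_int_is_int by simp
qed

lemma eigenvalue_product_int:
  assumes "m \<ge> 2" "m dvd n"
    "4 * (cayley_eigenvalue m (int i) * cayley_eigenvalue m (int j)) \<in> \<rat>"
  shows "4 * (cayley_eigenvalue m (int i) * cayley_eigenvalue m (int j)) \<in> \<int>"
proof (rule rational_mem_ring_imp_int[OF _ assms(3)])
  show "of_real (4 * (cayley_eigenvalue m (int i) * cayley_eigenvalue m (int j))) \<in> periodic_ring"
    using stabilizer_ring_mult[OF two_eigenvalue_mem_ring[OF assms(1,2), of i]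
      two_eigenvalue_mem_ring[OF assms(1,2), of j]] by (simp add: mult_ac)
qed

text \<open>
  For \<open>15\<close> and \<open>40\<close>, the product of two conjugate doubled eigenvalues is rational but not an integer.
\<close>

lemma fifteen_not_dvd: "\<not> 15 dvd n"
proof
  assume "15 dvd n"
  have eig: "cayley_eigenvalue 15 j = cos (pi * of_int j / 3) * cos (pi * of_int j / 5)" for j
  proof -
    have "cayley_eigenvalue 15 j = (cos (2 * pi * of_int j / 15) + cos (2 * pi * (4 * of_int j) / 15)) / 2"
      using cos_complement_mod[of 15 11 4 j] cos_complement_mod[of 15 14 1 j]
      unfolding cayley_eigenvalue_def quad_connection_set_concrete by (simp add: mult_ac)
    also have "\<dots> = cos (pi * of_int j / 3) * cos (- (pi * of_int j / 5))"
      unfolding cos_plus_cos by (simp add: field_simps)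
    finally show ?thesis
      by simp
  qed
  have "cos (pi * 2 / 3) = - 1 / 2"
    using cos_120 by (simp add: mult.commute)
  \<comment> \<open>Indices 1 and 2 produce \<open>cos (pi / 5) * cos (2 * pi / 5)\<close>, whose
    value is rational.\<close>
  then have "4 * (cayley_eigenvalue 15 (int 1) * cayley_eigenvalue 15 (int 2)) =
      - (cos (pi / 5) * cos (2 * pi / 5))"
    unfolding eig by (simp add: cos_60 mult.commute)
  then have eq: "4 * (cayley_eigenvalue 15 (int 1) * cayley_eigenvalue 15 (int 2)) = - 1 / 4"
    unfolding cos_pi_fifth_product by simp
  then have "(- 1 / 4 :: real) \<in> \<int>"
    using eigenvalue_product_int[of 15 1 2] \<open>15 dvd n\<close> unfolding eq by simp
  then obtain k :: int where "- 1 / 4 = real_of_int k"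
    by (elim Ints_cases)
  then have "real_of_int (4 * k) = real_of_int (- 1)"
    by simp
  then show False
    unfolding of_int_eq_iff by presburger
qed

lemma forty_not_dvd: "\<not> 40 dvd n"
proof
  assume "40 dvd n"
  have eig: "cayley_eigenvalue 40 j = cos (pi * of_int j / 4) * cos (pi * of_int j / 5)" for j
  proof -
    have "cayley_eigenvalue 40 j = (cos (2 * pi * of_int j / 40) + cos (2 * pi * (9 * of_int j) / 40)) / 2"
      using cos_complement_mod[of 40 31 9 j] cos_complement_mod[of 40 39 1 j]
      unfolding cayley_eigenvalue_def quad_connection_set_concrete by (simp add: mult_ac)
    also have "\<dots> = cos (pi * of_int j / 4) * cos (- (pi * of_int j / 5))"
      unfolding cos_plus_cos by (simp add: field_simps)
    finally show ?thesis
      by simp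
  qed
  have "cos (pi * 3 / 4) = cos (pi - pi / 4)" "cos (pi * 3 / 5) = cos (pi - 2 * pi / 5)"
    by (rule arg_cong[where f = cos], simp)+
  then have "cos (pi * 3 / 4) = - cos (pi / 4)" "cos (pi * 3 / 5) = - cos (2 * pi / 5)"
    by (simp_all only: cos_pi_minus)
  \<comment> \<open>For indices 1 and 3 the two signs from \<open>pi - x\<close> cancel, and
    \<open>cos (pi / 4)\<close> appears squared.\<close>
  then have "4 * (cayley_eigenvalue 40 (int 1) * cayley_eigenvalue 40 (int 3)) =
      4 * (cos (pi / 4))\<^sup>2 * (cos (pi / 5) * cos (2 * pi / 5))"
    unfolding eig by (simp add: power2_eq_square)
  then have eq: "4 * (cayley_eigenvalue 40 (int 1) * cayley_eigenvalue 40 (int 3)) = 1 / 2"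
    unfolding cos_pi_fifth_product by (simp add: cos_45 power_divide)
  then have "(1 / 2 :: real) \<in> \<int>"
    using eigenvalue_product_int[of 40 1 3] \<open>40 dvd n\<close> unfolding eq by simp
  then obtain k :: int where "1 / 2 = real_of_int k"
    by (elim Ints_cases)
  then have "real_of_int (2 * k) = real_of_int 1"
    by simp
  then show False
    unfolding of_int_eq_iff by presburger
qed

text \<open>
  Let \<open>d\<close> be the degree of the graph of the prime \<open>p\<close>. The squares of its doubled eigenvalues
  sum to \<open>4 * p / d\<close>, which must be an integer; as \<open>d < p\<close>, this means that \<open>d\<close> divides \<open>4\<close>.
\<close>

lemma prime_divisor_le_5:
  assumes "prime p" "p dvd n"
  shows "p \<le> 5"
proof (rule ccontr)
  assume "\<not> p \<le> 5"
  \<comment> \<open>The prime 7 is split off because the count of five distinct squares below uses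
    \<open>x + y <= 10 < p\<close>.\<close>
  moreover have "p \<noteq> 6" "p \<noteq> 8" "p \<noteq> 9" "p \<noteq> 10"
    using assms(1) prime_nat_iff[of p] by (auto dest: spec[of _ 2] spec[of _ 3])
  ultimately have p: "p = 7 \<or> p \<ge> 11"
    by linarith
  then have p2: "p \<ge> 2"
    by auto
  let ?V = "quad_connection_set p"
  let ?d = "card ?V"
  have d0: "?d > 0"
    by (rule card_quad_connection_set_pos[OF p2])
  have "(\<Sum>j<p. of_real (2 * cayley_eigenvalue p (int j)) * of_real (2 * cayley_eigenvalue p (int j))) \<in> periodic_ring"
    by (intro stabilizer_ring_sum stabilizer_ring_mult two_eigenvalue_mem_ring p2 assms(2))
  also have "(\<Sum>j<p. of_real (2 * cayley_eigenvalue p (int j)) * of_real (2 * cayley_eigenvalue p (int j))) =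
      complex_of_real (4 * (\<Sum>j<p. (cayley_eigenvalue p (int j))\<^sup>2))"
    by (simp add: sum_distrib_left power2_eq_square mult_ac)
  also have "\<dots> = complex_of_real (4 * real p / real ?d)"
    by (simp add: sum_cayley_eigenvalue_square[OF p2])
  finally have "4 * real p / real ?d \<in> \<int>"
    by (rule rational_mem_ring_imp_int) simp
  then obtain k :: int where "4 * real p / real ?d = of_int k"
    by (elim Ints_cases)
  then have "real_of_int (4 * int p) = real_of_int (k * int ?d)"
    using d0 by (simp add: field_simps)
  then have "int ?d dvd 4 * int p"
    unfolding of_int_eq_iff by simp
  then have "?d dvd 4 * p"
    by (metis of_nat_dvd_iff of_nat_mult of_nat_numeral)
  moreover have "?d < p"
  proof -
    have "0 \<notin> ?V"
      using coprime_mem_quad_connection_set[OF p2, of 0] p2 by auto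
    then have "?V \<subseteq> {1..<int p}"
      using quad_connection_set_subset[OF p2] by (force simp: order_le_less)
    from card_mono[OF _ this] show ?thesis
      using p2 by auto
  qed
  then have "coprime ?d p"
    using d0 assms(1) by (metis coprime_commute nat_dvd_not_less prime_imp_coprime)
  ultimately have "?d dvd 4"
    using coprime_dvd_mult_left_iff by blast
  then have "?d \<le> 4"
    by (rule dvd_imp_le) simp
  moreover have "?d \<ge> 5"
    using p
  proof
    assume "p = 7"
    then show ?thesis
      by (simp add: quad_connection_set_concrete)
  next
    assume p11: "p \<ge> 11"
    have "(\<lambda>x. x\<^sup>2 mod int p) ` {1..5} \<subseteq> ?V"
    proof (rule image_subsetI)
      fix x :: int assume "x \<in> {1..5}"
      then have "\<not> int p dvd x"
        using p11 by (auto dest: zdvd_imp_le)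
      then have "coprime x (int p)"
        using assms(1) by (metis coprime_commute prime_imp_coprime prime_nat_int_transfer)
      then show "x\<^sup>2 mod int p \<in> ?V"
        using mod_mem_quad_connection_set[OF p2, of x "x\<^sup>2"] by simp
    qed
    moreover have "inj_on (\<lambda>x. x\<^sup>2 mod int p) {1..5}"
    proof (rule inj_onI)
      fix x y :: int
      assume xy: "x \<in> {1..5}" "y \<in> {1..5}" "x\<^sup>2 mod int p = y\<^sup>2 mod int p"
      then have "int p dvd (x + y) * (x - y)"
        by (simp add: mod_eq_dvd_iff power2_eq_square algebra_simps)
      then have "int p dvd x + y \<or> int p dvd x - y"
        using assms(1) by (simp add: prime_dvd_mult_iff)
      moreover have "\<not> int p dvd x + y"
        using xy p11 by (auto dest!: zdvd_imp_le)
      ultimately have "[x = y] (mod int p)"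
        by (simp add: cong_iff_dvd_diff)
      then show "x = y"
        using xy p11 by (simp add: cong_def)
    qed
    ultimately have "card {1..5 :: int} \<le> ?d"
      using p2 by (intro card_inj_on_le) auto
    then show ?thesis
      by simp
  qed
  ultimately show False
    by simp
qed

text \<open>\<open>120 = 2^3 * 3 * 5\<close> collects the exponent bounds: at most 3 for the prime
  2, at most 1 for 3 and 5, and no other primes.\<close>

lemma dvd_120: "n dvd 120"
proof (rule multiplicity_le_imp_dvd)
  fix p :: nat
  assume p: "prime p"
  have "p ^ multiplicity p n dvd 120"
  proof (cases "p dvd n")
    case False
    then show ?thesis
      by (simp add: not_dvd_imp_multiplicity_0)
  next
    case True
    have "p \<noteq> 4"
      using p prime_nat_iff[of p] by (auto dest: spec[of _ 2])
    then consider "p = 2" | "p = 3 \<or> p = 5"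
      using prime_divisor_le_5[OF p True] prime_ge_2_nat[OF p] by linarith
    then show ?thesis
    proof cases
      case 1
      have "\<not> 2 ^ 4 dvd n"
        using sixteen_not_dvd by simp
      then have "multiplicity 2 n < 4"
        by (rule multiplicity_lessI[rotated 2]) (use n2 in auto)
      then have "2 ^ multiplicity 2 n dvd (2 ^ 3 :: nat)"
        by (intro le_imp_power_dvd) simp
      then have "2 ^ multiplicity 2 n dvd (2 ^ 3 * 15 :: nat)"
        by (rule dvd_mult2)
      then show ?thesis
        by (simp add: 1)
    next
      case 2
      then have "\<not> p ^ 2 dvd n"
        using odd_prime_square_not_dvd[OF p] by auto
      then have "multiplicity p n < 2"
        by (rule multiplicity_lessI[rotated 2]) (use n2 p in \<open>auto dest: prime_gt_1_nat\<close>)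
      then have "p ^ multiplicity p n dvd p ^ 1"
        by (intro le_imp_power_dvd) simp
      moreover have "p ^ 1 dvd 120"
        using 2 by auto
      ultimately show ?thesis
        by (rule dvd_trans)
    qed
  qed
  then show "multiplicity p n \<le> multiplicity p 120"
    using p by (intro multiplicity_geI) (auto dest: prime_gt_1_nat)
qed (use n2 in simp)

end

theorem theorem5p5:
  fixes n :: nat
  assumes "n \<ge> 2"
  shows "exhibits_pst (quad_unitary_cayley n) \<longleftrightarrow>
    n \<in> {10, 20} \<or>
    (\<exists>\<alpha> \<beta> :: nat. 1 \<le> \<alpha> \<and> \<alpha> \<le> 3 \<and> 0 \<le> \<beta> \<and> \<beta> \<le> 1 \<and> n = 2 ^ \<alpha> * 3 ^ \<beta>)"
proof -
  have "exhibits_pst (quad_unitary_cayley n) \<longleftrightarrow> n \<in> {2, 4, 6, 8, 10, 12, 20, 24}"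
  proof
    assume "exhibits_pst (quad_unitary_cayley n)"
    then obtain \<tau> where even: "even n" and \<tau>: "\<tau> > 0"
      "\<And>j. cos (real \<tau> * arccos (cayley_eigenvalue n (int j))) = (-1) ^ j"
      using exhibits_pst_quad_unitary_cayley_iff[OF assms] by auto
    note ctxt = assms \<tau>
    have dvd: "n dvd 120" "\<not> 15 dvd n" "\<not> 40 dvd n"
      using dvd_120[OF ctxt] fifteen_not_dvd[OF ctxt] forty_not_dvd[OF ctxt] by auto
    \<comment> \<open>The surviving even divisors of 120 are found by enumeration.\<close>
    then have "n \<in> set (filter (\<lambda>k. k dvd 120 \<and> even k \<and> \<not> 15 dvd k \<and> \<not> 40 dvd k) [0..<121])"
      using even by (auto dest: dvd_imp_le)
    also have "\<dots> = {2, 4, 6, 8, 10, 12, 20, 24}"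
      by code_simp
    finally show "n \<in> {2, 4, 6, 8, 10, 12, 20, 24}" .
  next
    assume "n \<in> {2, 4, 6, 8, 10, 12, 20, 24}"
    \<comment> \<open>Every listed \<open>n\<close> except 20 has the connection set
      \<open>{1, n - 1}\<close>; for \<open>n = 2\<close> both elements coincide.\<close>
    then show "exhibits_pst (quad_unitary_cayley n)"
      using exhibits_pst_20 exhibits_pst_cycle[OF assms]
      by (auto simp: quad_connection_set_concrete)
  qed
  also have "\<dots> \<longleftrightarrow> n \<in> {10, 20} \<or>
    (\<exists>\<alpha> \<beta> :: nat. 1 \<le> \<alpha> \<and> \<alpha> \<le> 3 \<and> 0 \<le> \<beta> \<and> \<beta> \<le> 1 \<and> n = 2 ^ \<alpha> * 3 ^ \<beta>)"
  proof -
    have "(\<exists>\<alpha> \<beta> :: nat. 1 \<le> \<alpha> \<and> \<alpha> \<le> 3 \<and> 0 \<le> \<beta> \<and> \<beta> \<le> 1 \<and> n = 2 ^ \<alpha> * 3 ^ \<beta>) \<longleftrightarrow>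
      (\<exists>\<alpha>\<in>{1, 2, 3}. \<exists>\<beta>\<in>{0, 1}. n = 2 ^ \<alpha> * 3 ^ \<beta>)"
    proof -
      have "\<alpha> \<in> {1, 2, 3} \<longleftrightarrow> 1 \<le> \<alpha> \<and> \<alpha> \<le> 3" "\<beta> \<in> {0, 1} \<longleftrightarrow> 0 \<le> \<beta> \<and> \<beta> \<le> 1" for \<alpha> \<beta> :: nat
        by auto
      then show ?thesis
        unfolding Bex_def by blast
    qed
    then show ?thesis
      by auto
  qed
  finally show ?thesis .
qed

end
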